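(* Let $\Phi_0(x) = |x|^2/4$ on $\mathbf{C}^n$ and $Q(x) = \lambda |x|^2 + \frac{1}{2} \overline{c} \cdot x - \frac{1}{2} d \cdot \overline{x}$, with $c,d \in \mathbf{C}^n$ and $\lambda \in \mathbf{C}$, $\mathrm{Re}\, \lambda < 1/4$. The Toeplitz operator $\mathrm{Top}(e^Q): H_{\Phi_0}(\mathbf{C}^n) \rightarrow H_{\Phi_0}(\mathbf{C}^n)$ is bounded if and only if the Weyl symbol $a\in C^{\infty}(\Lambda_{\Phi_0})$ of $\mathrm{Top}(e^Q)$ satisfies $a\in L^{\infty}(\Lambda_{\Phi_0})$.
   Context: Here $a\cdot b=\sum_j a_jb_j$ (bilinear). $\Lambda_{\Phi_0} = \{(x,\frac{2}{i}\frac{\partial \Phi_0}{\partial x}(x)) : x\in \mathbf{C}^n\}$. $H_{\Phi_0}(\mathbf{C}^n) = L^2(\mathbf{C}^n, e^{-2\Phi_0} L(dx)) \cap \mathrm{Hol}(\mathbf{C}^n)$, $\Pi_{\Phi_0}$ is the orthogonal projection from $L^2(\mathbf{C}^n, e^{-2\Phi_0}L(dx))$ onto $H_{\Phi_0}(\mathbf{C}^n)$, and $\mathrm{Top}(e^Q)=\Pi_{\Phi_0}\circ e^Q\circ\Pi_{\Phi_0}$ with natural dense domain $\{u\in H_{\Phi_0}: e^Qu\in L^2(\mathbf{C}^n,e^{-2\Phi_0}L(dx))\}$; bounded means bounded on this domain. The Weyl symbol of $\mathrm{Top}(e^Q)$ (the function $a$ on $\Lambda_{\Phi_0}$ with $\mathrm{Top}(e^Q)=a^w(x,D_x)$)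 is given by $a(x,\frac{2}{i}\frac{\partial\Phi_0}{\partial x}(x)) = \left(\exp(\tfrac14\Delta)e^Q\right)(x)=\pi^{-n}\int_{\mathbf{C}^n}e^{-|x-y|^2}e^{Q(y)}\,L(dy)$, where $\Delta$ is the Laplacian on $\mathbf{C}^n\simeq\mathbf{R}^{2n}$. *)

theory Defs
  imports "HOL-Analysis.Analysis"
begin

definition cdot :: "complex ^ 'n::finite \<Rightarrow> complex ^ 'n \<Rightarrow> complex" where
  "cdot a b = (\<Sum>j\<in>UNIV. a $ j * b $ j)"

definition vcnj :: "complex ^ 'n::finite \<Rightarrow> complex ^ 'n" where
  "vcnj a = (\<chi> j. cnj (a $ j))"

definition Phi0 :: "complex ^ 'n::finite \<Rightarrow> real" where
  "Phi0 x = (norm x)\<^sup>2 / 4"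

text \<open>Holomorphic functions on C^n: complex (Frechet) differentiable everywhere,
  i.e. real differentiable with complex-linear differential.\<close>
definition holo_Cn :: "(complex ^ 'n::finite \<Rightarrow> complex) \<Rightarrow> bool" where
  "holo_Cn f \<longleftrightarrow> (\<forall>x. \<exists>D. (f has_derivative D) (at x) \<and> (\<forall>v. D (\<i> *s v) = \<i> * D v))"

definition L2w :: "(complex ^ 'n::finite \<Rightarrow> complex) set" where
  "L2w = {u. u \<in> borel_measurable borel \<and>
              integrable lborel (\<lambda>x. (cmod (u x))\<^sup>2 * exp (- 2 * Phi0 x))}"

definition L2w_inner :: "(complex ^ 'n::finite \<Rightarrow> complex) \<Rightarrow> (complex ^ 'n \<Rightarrow> complex) \<Rightarrow> complex" where
  "L2w_inner u v = (\<integral>x. u x * cnj (v x) * complex_of_real (exp (- 2 * Phi0 x)) \<partial>lborel)"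

definition L2w_norm :: "(complex ^ 'n::finite \<Rightarrow> complex) \<Rightarrow> real" where
  "L2w_norm u = sqrt (\<integral>x. (cmod (u x))\<^sup>2 * exp (- 2 * Phi0 x) \<partial>lborel)"

definition H_Phi0 :: "(complex ^ 'n::finite \<Rightarrow> complex) set" where
  "H_Phi0 = {u \<in> L2w. holo_Cn u}"

definition Pi_Phi0 :: "(complex ^ 'n::finite \<Rightarrow> complex) \<Rightarrow> (complex ^ 'n \<Rightarrow> complex)" where
  "Pi_Phi0 v = (THE h. h \<in> H_Phi0 \<and> (\<forall>g\<in>H_Phi0. L2w_inner (\<lambda>x. v x - h x) g = 0))"

definition Top_dom :: "(complex ^ 'n::finite \<Rightarrow> complex) \<Rightarrow> (complex ^ 'n \<Rightarrow> complex) set" where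
  "Top_dom Q = {u \<in> H_Phi0. (\<lambda>x. exp (Q x) * u x) \<in> L2w}"

definition Top :: "(complex ^ 'n::finite \<Rightarrow> complex) \<Rightarrow> (complex ^ 'n \<Rightarrow> complex) \<Rightarrow> (complex ^ 'n \<Rightarrow> complex)" where
  "Top Q u = Pi_Phi0 (\<lambda>x. exp (Q x) * Pi_Phi0 u x)"

definition Top_bounded :: "(complex ^ 'n::finite \<Rightarrow> complex) \<Rightarrow> bool" where
  "Top_bounded Q \<longleftrightarrow> (\<exists>C. \<forall>u\<in>Top_dom Q. L2w_norm (Top Q u) \<le> C * L2w_norm u)"

text \<open>Weyl symbol of Top(e^Q), expressed via the parametrization
  x \<mapsto> (x, (2/i) dPhi_0/dx (x)) of Lambda_{Phi_0}:
  a(x, ...) = pi^{-n} \<integral> e^{-|x-y|^2} e^{Q(y)} L(dy).\<close>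
definition weyl_symbol_Top :: "(complex ^ 'n::finite \<Rightarrow> complex) \<Rightarrow> complex ^ 'n \<Rightarrow> complex" where
  "weyl_symbol_Top Q x = complex_of_real (pi powr (- real CARD('n))) *
      (\<integral>y. complex_of_real (exp (- (norm (x - y))\<^sup>2)) * exp (Q y) \<partial>lborel)"

text \<open>a \<in> L^\<infinity>(Lambda_{Phi_0}), the measure on Lambda being the image of Lebesgue measure
  under the parametrization (up to a constant, which does not matter).\<close>
definition Linfty_Lambda :: "(complex ^ 'n::finite \<Rightarrow> complex) \<Rightarrow> bool" where
  "Linfty_Lambda a \<longleftrightarrow> (\<exists>C. AE x in lborel. cmod (a x) \<le> C)"

end

theory Submission
  imports Defs "HOL-Complex_Analysis.Cauchy_Integral_Formula" "HOL-Probability.Distributions"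
begin

text \<open>
  For holomorphic F, rotating the variable and applying the mean value property on circles shows that
  the integral of exp(-a|y|^2) F(y) is F(0) times that of exp(-a|y|^2), even for complex a; after a
  translation, the integral of exp(q \<cdot> conj y - a|y|^2) F(y) is a constant N(a) times F(q/a).
  With \<mu> = 1 - 2\<lambda> this yields the reproducing property of H, turns Top(e^Q) into the weighted
  composition operator sending u to a constant times exp(conj c \<cdot> y / 2) u(y), y = (x - d)/\<mu>, and
  evaluates the Weyl symbol as a Gaussian. Substituting x = \<mu> y + d bounds Top(e^Q) from above,
  and coherent states bound it from below. Each of the two boundedness questions asks whether a real
  quadratic polynomial \<alpha>|w|^2 + Re(p \<cdot> conj w) is bounded above, and both are equivalent to
  |\<mu>| > 1, or |\<mu>| = 1 and c = conj(\<mu>) d.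
\<close>

subsection \<open>Lebesgue measure and Gaussians\<close>

text \<open>The parameter \<mu> arises because the weight exp(-|y|^2/2) times exp(\<lambda>|y|^2) is
  exp(-\<mu>|y|^2/2). An element of the domain of Top(e^Q) is controlled only through square
  integrability, so the Gaussian formula for F is proved under absolute integrability alone. The
  projection is a definite description, so its value is identified only through a candidate already
  known to lie in H. For the upper bound, the substitution supplies this membership together with
  the estimate; for the lower bound, coherent states go to multiples of exponentials. The quadratics
  have leading coefficients (1 - |\<mu>|^2)/2 for the upper bound, (1/|\<mu>|^2 - 1)/4 for the lower
  bound and Re(1/(1 - \<lambda>)) - 1 for the symbol. Since 1 - \<lambda> = (1 + \<mu>)/2, the last
  one is (1 - |\<mu>|^2)/|1 + \<mu>|^2, so all three have the same sign. On |\<mu>| = 1 the linear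
  terms decide, and they vanish together.\<close>

lemma vec_smult_linear: "linear (\<lambda>x::complex^'n. m *s x)"
  by (rule linearI) (auto simp: vec_eq_iff algebra_simps)

lemma norm_vec_smult: "norm (m *s (x::complex^'n::finite)) = cmod m * norm x"
  by (simp add: norm_vec_def norm_mult L2_set_right_distrib)

lemma continuous_on_vec_smult [continuous_intros]:
  fixes f :: "'a::topological_space \<Rightarrow> complex^'n::finite"
  assumes "continuous_on S g" "continuous_on S f"
  shows "continuous_on S (\<lambda>x. g x *s f x)"
  unfolding vector_scalar_mult_def by (intro continuous_intros assms)

lemma borel_measurable_vec_smult [measurable]:
  "(\<lambda>x::complex^'n::finite. m *s x) \<in> borel_measurable borel"
  by (intro borel_measurable_continuous_onI continuous_intros)

lemma nn_integral_lborel_shift: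
  fixes f :: "'a::euclidean_space \<Rightarrow> ennreal"
  assumes [measurable]: "f \<in> borel_measurable borel"
  shows "(\<integral>\<^sup>+x. f (x + t) \<partial>lborel) = (\<integral>\<^sup>+x. f x \<partial>lborel)"
proof -
  have "(\<integral>\<^sup>+x. f x \<partial>lborel) = (\<integral>\<^sup>+x. f x \<partial>distr lborel borel ((+) t))"
    by (simp add: lborel_distr_plus)
  also have "\<dots> = (\<integral>\<^sup>+x. f (x + t) \<partial>lborel)"
    by (subst nn_integral_distr) (auto simp: add.commute)
  finally show ?thesis by simp
qed

text \<open>The uniqueness argument for Haar measure: integrate f(m x + y) over x in the space and y in the
  unit ball in both orders, using only translation invariance and the symmetry of the ball.\<close>

lemma nn_integral_lborel_vec_smult:
  fixes f :: "complex^'n::finite \<Rightarrow> ennreal"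
  assumes [measurable]: "f \<in> borel_measurable borel" and m: "m \<noteq> 0"
  shows "(\<integral>\<^sup>+x. f (m *s x) \<partial>lborel) = ennreal ((1 / cmod m) ^ DIM(complex^'n)) * (\<integral>\<^sup>+x. f x \<partial>lborel)"
proof -
  define V :: ennreal where "V = emeasure lborel (ball (0::complex^'n) 1)"
  define B :: "complex^'n \<Rightarrow> ennreal" where "B = indicator (ball 0 1)"
  have [measurable]: "B \<in> borel_measurable borel"
    unfolding B_def by (intro borel_measurable_indicator) auto
  let ?S = "\<lambda>y::complex^'n. (1/m) *s y"
  have TS: "m *s (x + ?S y) = m *s x + y" for x y
    using m by (simp add: vec_eq_iff algebra_simps)
  have sh: "(\<integral>\<^sup>+x. f (m *s x) \<partial>lborel) = (\<integral>\<^sup>+x. f (m *s x + y) \<partial>lborel)" for y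
    using nn_integral_lborel_shift[of "\<lambda>x. f (m *s x)" "?S y"] unfolding TS by simp
  have V: "emeasure lborel (ball (0::complex^'n) r) = ennreal (unit_ball_vol (DIM(complex^'n)) * r ^ DIM(complex^'n))"
    if "r \<ge> 0" for r
    using emeasure_ball[OF that, of "0::complex^'n"] by simp
  have "(\<integral>\<^sup>+x. f (m *s x) \<partial>lborel) * V = (\<integral>\<^sup>+y. (\<integral>\<^sup>+x. f (m *s x) \<partial>lborel) * B y \<partial>lborel)"
    by (simp add: V_def B_def nn_integral_cmult_indicator)
  also have "\<dots> = (\<integral>\<^sup>+y. (\<integral>\<^sup>+x. f (m *s x + y) * B y \<partial>lborel) \<partial>lborel)"
  proof (rule nn_integral_cong)
    fix y
    show "(\<integral>\<^sup>+x. f (m *s x) \<partial>lborel) * B y = (\<integral>\<^sup>+x. f (m *s x + y) * B y \<partial>lborel)"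
      by (subst sh[of y]) (simp add: nn_integral_multc)
  qed
  also have "\<dots> = (\<integral>\<^sup>+x. (\<integral>\<^sup>+y. f (m *s x + y) * B y \<partial>lborel) \<partial>lborel)"
    by (rule lborel_pair.Fubini') measurable
  also have "\<dots> = (\<integral>\<^sup>+x. (\<integral>\<^sup>+y. f y * B (y - m *s x) \<partial>lborel) \<partial>lborel)"
  proof (rule nn_integral_cong)
    fix x
    show "(\<integral>\<^sup>+y. f (m *s x + y) * B y \<partial>lborel) = (\<integral>\<^sup>+y. f y * B (y - m *s x) \<partial>lborel)"
      using nn_integral_lborel_shift[of "\<lambda>y. f y * B (y - m *s x)" "m *s x"] by (simp add: add.commute)
  qed
  also have "\<dots> = (\<integral>\<^sup>+y. (\<integral>\<^sup>+x. f y * B (y - m *s x) \<partial>lborel) \<partial>lborel)"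
    by (rule lborel_pair.Fubini') measurable
  also have "\<dots> = (\<integral>\<^sup>+y. f y * (\<integral>\<^sup>+x. B (m *s x) \<partial>lborel) \<partial>lborel)"
  proof (rule nn_integral_cong)
    fix y
    \<comment> \<open>The ball is symmetric, so y - m x may be replaced by m (x - y/m); translating
      x then removes y, and the double integral becomes a product.\<close>
    have e: "B (y - m *s x) = B (m *s (x + ?S (-y)))" for x
      unfolding TS by (simp add: B_def indicator_def norm_minus_commute)
    have "(\<integral>\<^sup>+x. B (y - m *s x) \<partial>lborel) = (\<integral>\<^sup>+x. B (m *s x) \<partial>lborel)"
      unfolding e by (rule nn_integral_lborel_shift[of "\<lambda>x. B (m *s x)"]) measurable
    then show "(\<integral>\<^sup>+x. f y * B (y - m *s x) \<partial>lborel) = f y * (\<integral>\<^sup>+x. B (m *s x) \<partial>lborel)"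
      by (simp add: nn_integral_cmult)
  qed
  also have "\<dots> = (\<integral>\<^sup>+y. f y \<partial>lborel) * (\<integral>\<^sup>+x. B (m *s x) \<partial>lborel)"
    by (simp add: nn_integral_multc)
  \<comment> \<open>The scaling factor is found from balls alone: \<open>m *s x\<close> has norm |m|
    |x|, so the preimage of the unit ball is the ball of radius 1/|m|.\<close>
  also have "(\<integral>\<^sup>+x. B (m *s x) \<partial>lborel) = (\<integral>\<^sup>+x. indicator (ball (0::complex^'n) (1 / cmod m)) x \<partial>lborel)"
    by (rule nn_integral_cong) (use m in \<open>auto simp: B_def indicator_def norm_vec_smult field_simps\<close>)
  also have "\<dots> = ennreal ((1 / cmod m) ^ DIM(complex^'n)) * V"
    using V[of "1 / cmod m"] V[of 1] by (simp add: V_def ennreal_mult' mult.commute)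
  finally have "(\<integral>\<^sup>+x. f (m *s x) \<partial>lborel) * V = (ennreal ((1 / cmod m) ^ DIM(complex^'n)) * (\<integral>\<^sup>+x. f x \<partial>lborel)) * V"
    by (simp add: mult_ac)
  moreover have "V \<noteq> 0" "V \<noteq> \<infinity>"
    using V[of 1] unit_ball_vol_pos[of "real (DIM(complex^'n))"] by (auto simp: V_def simp del: unit_ball_vol_pos)
  ultimately show ?thesis
    by (metis mult_divide_eq_ennreal infinity_ennreal_def)
qed

lemma gaussian_integrable_real:
  assumes "b > (0::real)"
  shows "integrable lborel (\<lambda>t::real. exp (- b * t\<^sup>2))"
proof -
  \<comment> \<open>With variance 1/(2b) the normal density is a constant times exp(-b t^2).\<close>
  define s where "s = sqrt (1 / (2 * b))"
  have s: "s > 0" "s\<^sup>2 = 1 / (2 * b)" using assms by (auto simp: s_def)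
  have "integrable lborel (normal_density 0 s)" using s by simp
  then have "integrable lborel (\<lambda>t. sqrt (2 * pi * s\<^sup>2) * normal_density 0 s t)" by simp
  then show ?thesis
    using s assms by (simp add: normal_density_def field_simps)
qed

lemma gaussian_integrable:
  fixes b :: real
  assumes "b > 0"
  shows "integrable lborel (\<lambda>x::'a::euclidean_space. exp (- b * (norm x)\<^sup>2))"
proof (rule integrableI_nonneg)
  have e: "exp (- b * (norm x)\<^sup>2) = (\<Prod>i\<in>Basis. exp (- b * (x \<bullet> i)\<^sup>2))" for x :: 'a
    unfolding power2_norm_eq_inner euclidean_inner[of x x]
    by (simp add: exp_sum sum_distrib_left power2_eq_square flip: sum_negf)
  have "(\<integral>\<^sup>+x. ennreal (exp (- b * (norm (x::'a))\<^sup>2)) \<partial>lborel) =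
      (\<integral>\<^sup>+(x::'a). (\<Prod>i\<in>Basis. ennreal (exp (- b * (x \<bullet> i)\<^sup>2))) \<partial>lborel)"
    unfolding e by (simp add: prod_ennreal)
  also have "\<dots> = (\<Prod>i\<in>(Basis::'a set). (\<integral>\<^sup>+t. ennreal (exp (- b * t\<^sup>2)) \<partial>lborel))"
    by (rule nn_integral_lborel_prod) auto
  also have "\<dots> < \<infinity>"
    using nn_integral_eq_integral[OF gaussian_integrable_real[OF assms]]
    by (simp add: ennreal_power)
  finally show "(\<integral>\<^sup>+x. ennreal (exp (- b * (norm (x::'a))\<^sup>2)) \<partial>lborel) < \<infinity>" .
qed auto

lemma gaussian_integrable_linear:
  fixes b :: real
  assumes "b > 0"
  shows "integrable lborel (\<lambda>x::'a::euclidean_space. exp (- b * (norm x)\<^sup>2 + C * norm x))"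
proof (rule Bochner_Integration.integrable_bound)
  show "integrable lborel (\<lambda>x::'a. exp (C\<^sup>2 / (2 * b)) * exp (- (b/2) * (norm x)\<^sup>2))"
    using gaussian_integrable[of "b/2"] assms by simp
  \<comment> \<open>Half of the Gaussian absorbs the linear term; completing the square leaves the
    constant C^2/(2b).\<close>
  have "- b * t\<^sup>2 + C * t \<le> C\<^sup>2 / (2 * b) + - (b/2) * t\<^sup>2" for t
  proof -
    have "0 \<le> (b * t - C)\<^sup>2 / (2 * b)" using assms by simp
    also have "\<dots> = b * t\<^sup>2 / 2 - C * t + C\<^sup>2 / (2 * b)"
      using assms by (simp add: field_simps power2_eq_square)
    finally show ?thesis by simp
  qed
  then show "AE x::'a in lborel. norm (exp (- b * (norm x)\<^sup>2 + C * norm x))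
      \<le> norm (exp (C\<^sup>2 / (2 * b)) * exp (- (b/2) * (norm x)\<^sup>2))"
    by (simp flip: exp_add)
qed auto

text \<open>As an identity of measures, the scaling formula for nonnegative functions carries over
  to Bochner integrals of complex functions, integrability and value at once.\<close>

lemma distr_lborel_vec_smult:
  assumes "m \<noteq> 0"
  shows "distr lborel borel (\<lambda>x::complex^'n::finite. m *s x)
    = density lborel (\<lambda>_. ennreal ((1 / cmod m) ^ DIM(complex^'n)))"
proof (rule measure_eqI)
  fix A assume "A \<in> sets (distr lborel borel (\<lambda>x::complex^'n. m *s x))"
  then have [measurable]: "A \<in> sets borel" by simp
  have "emeasure (distr lborel borel (\<lambda>x::complex^'n. m *s x)) A
      = (\<integral>\<^sup>+x. indicator A x \<partial>distr lborel borel (\<lambda>x::complex^'n. m *s x))"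
    by simp
  also have "\<dots> = (\<integral>\<^sup>+x. indicator A (m *s x) \<partial>lborel)"
    by (subst nn_integral_distr) auto
  also have "\<dots> = ennreal ((1 / cmod m) ^ DIM(complex^'n)) * emeasure lborel A"
    by (subst nn_integral_lborel_vec_smult[OF _ assms]) auto
  finally show "emeasure (distr lborel borel (\<lambda>x::complex^'n. m *s x)) A =
      emeasure (density lborel (\<lambda>_. ennreal ((1 / cmod m) ^ DIM(complex^'n)))) A"
    by (simp add: emeasure_density nn_integral_cmult_indicator)
qed simp

lemma has_bochner_integral_lborel_vec_smult:
  fixes f :: "complex^'n::finite \<Rightarrow> 'b::{banach, second_countable_topology}"
  assumes f: "integrable lborel f" and m: "m \<noteq> 0"
  shows "has_bochner_integral lborel (\<lambda>x. f (m *s x)) ((1 / cmod m) ^ DIM(complex^'n) *\<^sub>R (\<integral>x. f x \<partial>lborel))"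
proof -
  have [measurable]: "f \<in> borel_measurable borel" using f by simp
  let ?K = "(1 / cmod m) ^ DIM(complex^'n)"
  have "has_bochner_integral (density lborel (\<lambda>_. ennreal ?K)) f (?K *\<^sub>R (\<integral>x. f x \<partial>lborel))"
    using f by (intro has_bochner_integral_density) (auto intro!: has_bochner_integral_scaleR_right simp: has_bochner_integral_integrable)
  then show ?thesis
    unfolding distr_lborel_vec_smult[OF m, symmetric]
    by (auto simp: has_bochner_integral_iff integral_distr integrable_distr_eq)
qed

lemma has_bochner_integral_lborel_shift:
  fixes f :: "'a::euclidean_space \<Rightarrow> 'b::{banach, second_countable_topology}"
  assumes f: "integrable lborel f"
  shows "has_bochner_integral lborel (\<lambda>x. f (x + t)) (\<integral>x. f x \<partial>lborel)"
proof -
  have [measurable]: "f \<in> borel_measurable borel" using f by simp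
  have "has_bochner_integral (distr lborel borel ((+) t)) f (\<integral>x. f x \<partial>lborel)"
    using f by (simp add: lborel_distr_plus has_bochner_integral_integrable)
  then show ?thesis
    by (auto simp: has_bochner_integral_iff integral_distr integrable_distr_eq add.commute)
qed

subsection \<open>The bilinear form and holomorphic functions\<close>

lemma cdot_add_left: "cdot (a + b) x = cdot a x + cdot b x"
  and cdot_add_right: "cdot x (a + b) = cdot x a + cdot x b"
  and cdot_diff_left: "cdot (a - b) x = cdot a x - cdot b x"
  and cdot_diff_right: "cdot x (a - b) = cdot x a - cdot x b"
  and cdot_smult_left: "cdot (m *s a) x = m * cdot a x"
  and cdot_smult_right: "cdot x (m *s a) = m * cdot x a"
  and cdot_commute: "cdot a x = cdot x a"
  and cdot_scaleR_right: "cdot x (r *\<^sub>R a) = of_real r * cdot x a"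
  by (simp_all add: cdot_def algebra_simps sum.distrib sum_subtractf sum_distrib_left scaleR_conv_of_real[where 'a=complex])

lemma cdot_zero [simp]: "cdot 0 x = 0" "cdot x 0 = 0"
  by (simp_all add: cdot_def)

lemma cdot_minus_left: "cdot (- a) x = - cdot a x"
  by (simp add: cdot_def sum_negf)

lemmas cdot_linear = cdot_minus_left cdot_add_left cdot_add_right cdot_diff_left cdot_diff_right
  cdot_smult_left cdot_smult_right

lemma vcnj_add: "vcnj (a + b) = vcnj a + vcnj b"
  and vcnj_diff: "vcnj (a - b) = vcnj a - vcnj b"
  and vcnj_smult: "vcnj (m *s a) = cnj m *s vcnj a"
  and vcnj_vcnj [simp]: "vcnj (vcnj a) = a"
  and vcnj_zero [simp]: "vcnj 0 = 0"
  by (simp_all add: vcnj_def vec_eq_iff)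

lemmas vcnj_linear = vcnj_add vcnj_diff vcnj_smult

lemma cnj_cdot: "cnj (cdot a b) = cdot (vcnj a) (vcnj b)"
  by (simp add: cdot_def vcnj_def)

lemma norm_vcnj [simp]: "norm (vcnj a) = norm a"
  by (simp add: norm_vec_def vcnj_def)

lemma cdot_vcnj_self: "cdot x (vcnj x) = of_real ((norm x)\<^sup>2)"
  by (simp add: cdot_def vcnj_def norm_vec_def L2_set_def sum_nonneg complex_norm_square flip: of_real_power)

lemma Re_cdot_vcnj_commute: "Re (cdot a (vcnj b)) = Re (cdot b (vcnj a))"
proof -
  have "cdot a (vcnj b) = cnj (cdot b (vcnj a))"
    by (simp add: cnj_cdot cdot_commute)
  then show ?thesis by simp
qed

lemma norm_add_sqr_cdot:
  "(norm (a + b))\<^sup>2 = (norm a)\<^sup>2 + 2 * Re (cdot a (vcnj b)) + (norm (b::complex^'n::finite))\<^sup>2"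
proof -
  have "(norm x)\<^sup>2 = Re (cdot x (vcnj x))" for x :: "complex^'n"
    by (simp add: cdot_vcnj_self)
  then show ?thesis
    using Re_cdot_vcnj_commute[of a b] by (simp add: vcnj_linear cdot_linear)
qed

lemma norm_cdot_le: "cmod (cdot a b) \<le> norm a * norm (b::complex^'n::finite)"
proof -
  have "cmod (cdot a b) \<le> (\<Sum>j\<in>UNIV. \<bar>cmod (a $ j)\<bar> * \<bar>cmod (b $ j)\<bar>)"
    unfolding cdot_def by (rule order_trans[OF norm_sum]) (simp add: norm_mult)
  also have "\<dots> \<le> norm a * norm b"
    unfolding norm_vec_def by (rule L2_set_mult_ineq)
  finally show ?thesis .
qed

lemma continuous_on_cdot [continuous_intros]:
  fixes f g :: "'a::topological_space \<Rightarrow> complex^'n::finite"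
  assumes "continuous_on S f" "continuous_on S g"
  shows "continuous_on S (\<lambda>x. cdot (f x) (g x))"
  unfolding cdot_def by (intro continuous_intros assms)

lemma continuous_on_vcnj [continuous_intros]:
  fixes f :: "'a::topological_space \<Rightarrow> complex^'n::finite"
  assumes "continuous_on S f"
  shows "continuous_on S (\<lambda>x. vcnj (f x))"
  unfolding vcnj_def by (intro continuous_intros assms)

lemma borel_measurable_cnj [measurable (raw)]:
  assumes "f \<in> borel_measurable M"
  shows "(\<lambda>x. cnj (f x)) \<in> borel_measurable M"
  by (rule measurable_compose[OF assms]) (intro borel_measurable_continuous_onI continuous_intros)

lemma continuous_on_Phi0 [continuous_intros]: "continuous_on S Phi0"
  unfolding Phi0_def by (intro continuous_intros) auto

lemma borel_measurable_Phi0 [measurable]: "Phi0 \<in> borel_measurable borel"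
  by (intro borel_measurable_continuous_onI continuous_intros)

lemma holo_Cn_continuous_on: "holo_Cn f \<Longrightarrow> continuous_on S f"
  unfolding holo_Cn_def
  by (meson continuous_at_imp_continuous_on has_derivative_continuous)

lemma holo_Cn_measurable: "holo_Cn f \<Longrightarrow> f \<in> borel_measurable borel"
  by (intro borel_measurable_continuous_onI holo_Cn_continuous_on)

lemma holo_Cn_const: "holo_Cn (\<lambda>x. k)"
  unfolding holo_Cn_def by (auto intro!: exI[of _ "\<lambda>v. 0"] derivative_eq_intros)

lemma bounded_linear_cdot: "bounded_linear (cdot p)"
  by (rule bounded_linear_intro[where K="norm p"])
    (auto simp: cdot_add_right cdot_scaleR_right scaleR_conv_of_real[where 'a=complex] intro: order_trans[OF norm_cdot_le] simp: mult.commute)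

lemma holo_Cn_cdot: "holo_Cn (cdot p)"
  unfolding holo_Cn_def
  by (auto intro!: exI[of _ "cdot p"] bounded_linear.has_derivative[OF bounded_linear_cdot] derivative_eq_intros
      simp: cdot_smult_right bounded_linear_imp_has_derivative bounded_linear_cdot)

lemma holo_Cn_mult:
  assumes "holo_Cn f" "holo_Cn g"
  shows "holo_Cn (\<lambda>x. f x * g x)"
  unfolding holo_Cn_def
proof
  fix x
  obtain D E where D: "(f has_derivative D) (at x)" "\<forall>v. D (\<i> *s v) = \<i> * D v"
    and E: "(g has_derivative E) (at x)" "\<forall>v. E (\<i> *s v) = \<i> * E v"
    using assms unfolding holo_Cn_def by meson
  show "\<exists>D. ((\<lambda>x. f x * g x) has_derivative D) (at x) \<and> (\<forall>v. D (\<i> *s v) = \<i> * D v)"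
    using has_derivative_mult[OF D(1) E(1)] D(2) E(2)
    by (intro exI[of _ "\<lambda>h. f x * E h + D h * g x"]) (auto simp: algebra_simps)
qed

lemma holo_Cn_exp:
  assumes "holo_Cn f"
  shows "holo_Cn (\<lambda>x. exp (f x))"
  unfolding holo_Cn_def
proof
  fix x
  obtain D where D: "(f has_derivative D) (at x)" "\<forall>v. D (\<i> *s v) = \<i> * D v"
    using assms unfolding holo_Cn_def by meson
  have "(exp has_derivative (*) (exp (f x))) (at (f x))"
    using DERIV_exp[of "f x"] by (simp add: has_field_derivative_def)
  from has_derivative_compose[OF D(1) this] D(2)
  show "\<exists>D. ((\<lambda>x. exp (f x)) has_derivative D) (at x) \<and> (\<forall>v. D (\<i> *s v) = \<i> * D v)"
    by (intro exI[of _ "\<lambda>h. exp (f x) * D h"]) (auto simp: algebra_simps)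
qed

lemma bounded_linear_vec_smult: "bounded_linear (\<lambda>x::complex^'n::finite. m *s x)"
  using vec_smult_linear linear_conv_bounded_linear by blast

lemma holo_Cn_affine:
  assumes "holo_Cn f"
  shows "holo_Cn (\<lambda>x. f (m *s x + s))"
  unfolding holo_Cn_def
proof
  fix x
  obtain D where D: "(f has_derivative D) (at (m *s x + s))" "\<forall>v. D (\<i> *s v) = \<i> * D v"
    using assms unfolding holo_Cn_def by meson
  have "((\<lambda>x. m *s x + s) has_derivative (\<lambda>h. m *s h)) (at x)"
    by (auto intro!: derivative_eq_intros bounded_linear_imp_has_derivative bounded_linear_vec_smult)
  from has_derivative_compose[OF this D(1)] D(2)
  show "\<exists>D. ((\<lambda>x. f (m *s x + s)) has_derivative D) (at x) \<and> (\<forall>v. D (\<i> *s v) = \<i> * D v)"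
    by (intro exI[of _ "\<lambda>h. D (m *s h)"]) (auto simp: vector_smult_assoc mult.commute[of m] simp flip: D(2))
qed

section \<open>Mean values on circles and Gaussian integrals of holomorphic functions\<close>

lemma holo_Cn_line:
  assumes "holo_Cn f"
  shows "(\<lambda>z. f (z *s y)) holomorphic_on UNIV"
proof (rule holomorphic_onI)
  fix z
  obtain D where D: "(f has_derivative D) (at (z *s y))" "\<forall>v. D (\<i> *s v) = \<i> * D v"
    using assms unfolding holo_Cn_def by meson
  interpret D: bounded_linear D using D(1) by (rule has_derivative_bounded_linear)
  \<comment> \<open>Real linearity together with compatibility with i makes the differential along
    the line a multiplication by \<open>D y\<close>, that is, a complex derivative. One-variable
    Cauchy theory becomes available.\<close>
  have "D (h *s y) = D y * h" for h
  proof -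
    have "h *s y = Re h *\<^sub>R y + Im h *\<^sub>R (\<i> *s y)"
      by (simp add: vec_eq_iff complex_eq_iff)
    then have "D (h *s y) = Re h *\<^sub>R D y + Im h *\<^sub>R (\<i> * D y)"
      using D(2) by (simp add: D.add D.scaleR)
    also have "\<dots> = D y * h" by (simp add: complex_eq_iff)
    finally show ?thesis .
  qed
  moreover have "((\<lambda>z. z *s y) has_derivative (\<lambda>h. h *s y)) (at z)"
  proof (rule bounded_linear_imp_has_derivative)
    show "bounded_linear (\<lambda>h::complex. h *s y)"
      by (rule bounded_linear_intro[where K="norm y"])
        (auto simp: vec_eq_iff algebra_simps norm_vec_smult scaleR_conv_of_real[where 'a=complex])
  qed
  note has_derivative_compose[OF this D(1)]
  ultimately have "((\<lambda>z. f (z *s y)) has_field_derivative D y) (at z)"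
    by (simp add: has_field_derivative_def)
  then show "(\<lambda>z. f (z *s y)) field_differentiable at z within UNIV"
    by (auto simp: field_differentiable_def)
qed

text \<open>Cauchy's formula at the center of the unit circle, where dz/z becomes 2 pi i dt. The
  Lebesgue integral with an indicator is the form that Fubini accepts later.\<close>

lemma circle_mean:
  assumes "g holomorphic_on UNIV"
  shows "(\<integral>t. indicator {0..1::real} t *\<^sub>R g (exp (2 * of_real pi * \<i> * of_real t)) \<partial>lborel) = g 0"
proof -
  have cont: "continuous_on UNIV g" using assms holomorphic_on_imp_continuous_on by blast
  let ?h = "\<lambda>t::real. g (exp (2 * of_real pi * \<i> * of_real t))"
  have "((\<lambda>u. g u/(u-0)) has_contour_integral (2 * of_real pi * \<i> * g 0)) (circlepath 0 1)"
    by (rule Cauchy_integral_circlepath_simple) (use assms holomorphic_on_subset in auto)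
  then have "((\<lambda>t. ?h t * (2 * of_real pi * \<i>)) has_integral (2 * of_real pi * \<i> * g 0)) {0..1}"
    unfolding has_contour_integral_def
    by (rule has_integral_eq[rotated]) (subst vector_derivative_circlepath01; simp add: circlepath)
  then have "((\<lambda>t. ?h t * (2 * of_real pi * \<i>) * inverse (2 * of_real pi * \<i>)) has_integral
      (2 * of_real pi * \<i> * g 0 * inverse (2 * of_real pi * \<i>))) {0..1}"
    by (rule has_integral_mult_left)
  then have "(?h has_integral g 0) {0..1}" by (simp add: field_simps)
  moreover have "set_integrable lborel {0..1} ?h"
    by (intro borel_integrable_atLeastAtMost' continuous_on_compose2[OF cont] continuous_intros) auto
  note set_borel_integral_eq_integral(2)[OF this]
  ultimately show ?thesis
    by (simp add: set_lebesgue_integral_def integral_unique)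
qed

text \<open>The constant N(a), equal to (pi/a)^n for Re a > 0. The proof treats it as an opaque
  factor that is nonzero for Re a > 0 and positive for real a > 0. The type argument fixes the
  dimension.\<close>

definition gaussC :: "'n::finite itself \<Rightarrow> complex \<Rightarrow> complex" where
  "gaussC _ a = (\<integral>y. exp (- a * of_real ((norm y)\<^sup>2)) \<partial>(lborel :: (complex^'n) measure))"

lemma gauss_mean_value:
  fixes H :: "complex^'n::finite \<Rightarrow> complex"
  assumes H: "holo_Cn H" and int: "integrable lborel (\<lambda>z. exp (- a * of_real ((norm z)\<^sup>2)) * H z)"
  shows "(\<integral>z. exp (- a * of_real ((norm z)\<^sup>2)) * H z \<partial>lborel) = gaussC TYPE('n) a * H 0"
proof -
  let ?e = "\<lambda>t::real. exp (2 * of_real pi * \<i> * of_real t) :: complex"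
  let ?p = "\<lambda>z::complex^'n. exp (- a * of_real ((norm z)\<^sup>2)) :: complex"
  let ?F = "\<lambda>z. ?p z * H z"
  have e1: "cmod (?e t) = 1" "?e t \<noteq> 0" for t by simp_all
  have [measurable]: "H \<in> borel_measurable borel" by (rule holo_Cn_measurable[OF H])
  have rot: "has_bochner_integral lborel (\<lambda>z. f (?e t *s z)) (\<integral>z. f z \<partial>lborel)"
    if "integrable lborel f" for t and f :: "complex^'n \<Rightarrow> 'b::{banach, second_countable_topology}"
    using has_bochner_integral_lborel_vec_smult[OF that e1(2)[of t]] by (simp add: e1)
  have Fe: "?F (?e t *s z) = ?p z * H (?e t *s z)" for t z
    by (simp add: norm_vec_smult)
  define f where "f = (\<lambda>t z. indicator {0..1::real} t *\<^sub>R (?p z * H (?e t *s z)))"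
  have meas[measurable]: "(\<lambda>x. H (?e (fst x) *s snd x)) \<in> borel_measurable (borel \<Otimes>\<^sub>M borel)"
    unfolding borel_prod
    by (intro borel_measurable_continuous_onI continuous_on_compose2[OF holo_Cn_continuous_on[OF H, of UNIV]] continuous_intros) auto
  have fm: "case_prod f \<in> borel_measurable (lborel \<Otimes>\<^sub>M lborel)"
    unfolding f_def case_prod_beta by measurable
  have integrable: "integrable (lborel \<Otimes>\<^sub>M lborel) (case_prod f)"
  proof (rule lborel_pair.Fubini_integrable[OF fm])
    \<comment> \<open>Rotations preserve the weight and Lebesgue measure, so the inner norm integral
      does not depend on t in [0,1]. Absolute integrability of the original integrand is therefore
      enough for Fubini.\<close>
    have "(\<integral>z. norm (case_prod f (t, z)) \<partial>lborel) = indicator {0..1} t * (\<integral>z. norm (?F z) \<partial>lborel)" for t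
      using rot[OF integrable_norm[OF int], of t] unfolding Fe
      by (auto simp: f_def Fe has_bochner_integral_iff norm_mult indicator_def)
    then show "integrable lborel (\<lambda>t. \<integral>z. norm (case_prod f (t, z)) \<partial>lborel)"
      by simp
    show "AE t in lborel. integrable lborel (\<lambda>z. case_prod f (t, z))"
      using rot[OF int] unfolding Fe by (auto simp: f_def has_bochner_integral_iff)
  qed
  have "(\<integral>z. ?F z \<partial>lborel) = (\<integral>t. indicator {0..1::real} t *\<^sub>R (\<integral>z. ?F z \<partial>lborel) \<partial>lborel)"
    by (simp add: measure_def)
  also have "\<dots> = (\<integral>t. \<integral>z. f t z \<partial>lborel \<partial>lborel)"
    using rot[OF int] unfolding Fe f_def by (auto simp: has_bochner_integral_iff intro!: Bochner_Integration.integral_cong)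
  also have "\<dots> = (\<integral>z. \<integral>t. f t z \<partial>lborel \<partial>lborel)"
    by (rule lborel_pair.Fubini_integral[OF integrable, symmetric])
  also have "\<dots> = (\<integral>z. ?p z * H 0 \<partial>lborel)"
  proof (rule Bochner_Integration.integral_cong[OF refl])
    fix z
    have "(\<integral>t. f t z \<partial>lborel) = ?p z * (\<integral>t. indicator {0..1::real} t *\<^sub>R H (?e t *s z) \<partial>lborel)"
      unfolding f_def by (simp flip: mult_scaleR_right)
    also have "\<dots> = ?p z * H 0"
      using circle_mean[OF holo_Cn_line[OF H, of z]] by simp
    finally show "(\<integral>t. f t z \<partial>lborel) = ?p z * H 0" .
  qed
  also have "\<dots> = gaussC TYPE('n) a * H 0" by (simp add: gaussC_def)
  finally show ?thesis .
qed

text \<open>The translation y = z + s with s = q/a is chosen to cancel the antiholomorphic term: the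
  exponent becomes -a|z|^2 - a (conj s \<cdot> z), the two multiples of |s|^2 cancelling as well.
  What remains beside the Gaussian is holomorphic in z, and its exponential factor is 1 at z =
  0.\<close>

lemma gauss_shifted:
  fixes F :: "complex^'n::finite \<Rightarrow> complex"
  assumes F: "holo_Cn F" and a: "a \<noteq> 0"
    and int: "integrable lborel (\<lambda>y. exp (cdot q (vcnj y) - a * of_real ((norm y)\<^sup>2)) * F y)"
  shows "(\<integral>y. exp (cdot q (vcnj y) - a * of_real ((norm y)\<^sup>2)) * F y \<partial>lborel)
    = gaussC TYPE('n) a * F ((1 / a) *s q)"
proof -
  define s where "s = (1 / a) *s q"
  have q: "q = a *s s" using a by (simp add: s_def vec_eq_iff)
  let ?f = "\<lambda>y. exp (cdot q (vcnj y) - a * of_real ((norm y)\<^sup>2)) * F y"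
  define H where "H = (\<lambda>z. exp (cdot (- a *s vcnj s) z) * F (1 *s z + s))"
  have H: "holo_Cn H"
    unfolding H_def by (intro holo_Cn_mult holo_Cn_exp holo_Cn_cdot holo_Cn_affine F)
  have e: "?f (z + s) = exp (- a * of_real ((norm z)\<^sup>2)) * H z" for z
  proof -
    have "cdot q (vcnj (z + s)) - a * of_real ((norm (z + s))\<^sup>2) = - a * of_real ((norm z)\<^sup>2) + cdot (- a *s vcnj s) z"
      unfolding q cdot_vcnj_self[symmetric]
      by (simp add: cdot_linear vcnj_linear algebra_simps cdot_commute[of "vcnj s" z])
    then show ?thesis by (simp only: H_def exp_add) simp
  qed
  have "has_bochner_integral lborel (\<lambda>z. ?f (z + s)) (\<integral>y. ?f y \<partial>lborel)"
    by (rule has_bochner_integral_lborel_shift[OF int])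
  then have "has_bochner_integral lborel (\<lambda>z. exp (- a * of_real ((norm z)\<^sup>2)) * H z) (\<integral>y. ?f y \<partial>lborel)"
    unfolding e .
  then have "(\<integral>y. ?f y \<partial>lborel) = gaussC TYPE('n) a * H 0"
    using gauss_mean_value[OF H] by (auto simp: has_bochner_integral_iff)
  also have "H 0 = F ((1 / a) *s q)"
    by (simp add: H_def s_def)
  finally show ?thesis .
qed

subsection \<open>Gaussian integrals with a complex parameter\<close>

lemma gauss_integrable_bound:
  fixes f :: "complex^'n::finite \<Rightarrow> complex"
  assumes "continuous_on UNIV f" "b > 0" "\<And>y. cmod (f y) \<le> K * exp (- b * (norm y)\<^sup>2 + C * norm y)"
  shows "integrable lborel f"
proof (rule Bochner_Integration.integrable_bound)
  show "integrable lborel (\<lambda>y::complex^'n. K * exp (- b * (norm y)\<^sup>2 + C * norm y))"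
    by (intro integrable_mult_right gaussian_integrable_linear assms)
  show "AE y in lborel. norm (f y) \<le> norm (K * exp (- b * (norm y)\<^sup>2 + C * norm y))"
    using assms(3) by (intro always_eventually allI order_trans[OF assms(3)]) simp
qed (use assms(1) borel_measurable_continuous_onI in auto)

lemma gauss_exp_integrable:
  fixes p q :: "complex^'n::finite"
  assumes "Re a > 0"
  shows "integrable lborel (\<lambda>y. exp (cdot q (vcnj y) - a * of_real ((norm y)\<^sup>2)) * exp (cdot p y))"
proof (rule gauss_integrable_bound[OF _ assms, where K=1 and C="norm p + norm q"])
  show "continuous_on UNIV (\<lambda>y. exp (cdot q (vcnj y) - a * of_real ((norm y)\<^sup>2)) * exp (cdot p y))"
    by (intro continuous_intros)
  show "cmod (exp (cdot q (vcnj y) - a * of_real ((norm y)\<^sup>2)) * exp (cdot p y))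
      \<le> 1 * exp (- Re a * (norm y)\<^sup>2 + (norm p + norm q) * norm y)" for y
    using order_trans[OF complex_Re_le_cmod norm_cdot_le[of q "vcnj y"]]
      order_trans[OF complex_Re_le_cmod norm_cdot_le[of p y]]
    by (simp add: algebra_simps flip: exp_add)
qed

lemma gauss_exp_integral:
  fixes p q :: "complex^'n::finite"
  assumes "Re a > 0"
  shows "(\<integral>y. exp (cdot q (vcnj y) - a * of_real ((norm y)\<^sup>2)) * exp (cdot p y) \<partial>lborel)
    = gaussC TYPE('n) a * exp (cdot p q / a)"
proof -
  have "a \<noteq> 0" using assms by auto
  show ?thesis
    by (subst gauss_shifted[OF holo_Cn_exp[OF holo_Cn_cdot] \<open>a \<noteq> 0\<close> gauss_exp_integrable[OF assms]])
      (simp add: cdot_smult_right)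
qed

lemma gaussC_of_real_pos:
  assumes "b > (0::real)"
  obtains r where "r > 0" "gaussC TYPE('n::finite) (of_real b) = of_real r"
proof
  let ?I = "\<integral>y. exp (- b * (norm y)\<^sup>2) \<partial>(lborel :: (complex^'n) measure)"
  show "gaussC TYPE('n) (of_real b) = of_real ?I"
    unfolding gaussC_def by (simp flip: exp_of_real integral_complex_of_real)
  have "?I \<noteq> 0"
  proof
    assume "?I = 0"
    then have "AE y in (lborel :: (complex^'n) measure). exp (- b * (norm y)\<^sup>2) = 0"
      by (subst (asm) integral_nonneg_eq_0_iff_AE[OF gaussian_integrable[OF assms]]) auto
    then have "AE y in (lborel :: (complex^'n) measure). False" by simp
    then show False by (simp add: eventually_False ae_filter_eq_bot_iff)
  qed
  moreover have "?I \<ge> 0" by simp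
  ultimately show "?I > 0" by (metis order_le_less)
qed

text \<open>Fubini for exp(-b|x|^2 - a|y|^2 + x \<cdot> conj y - conj x \<cdot> y), whose mixed term has modulus one.\<close>

lemma gaussC_inversion:
  assumes a: "Re a > 0" and b: "b > (0::real)"
  shows "gaussC TYPE('n::finite) a * gaussC TYPE('n) (of_real b + 1 / a)
    = gaussC TYPE('n) (of_real b) * gaussC TYPE('n) (a + 1 / of_real b)"
proof -
  let ?G = "\<lambda>c (y::complex^'n). exp (- c * of_real ((norm y)\<^sup>2)) :: complex"
  define f where "f = (\<lambda>x y::complex^'n. ?G b x * ?G a y * exp (cdot x (vcnj y) - cdot y (vcnj x)))"
  have nf: "cmod (f x y) = exp (- b * (norm x)\<^sup>2) * exp (- Re a * (norm y)\<^sup>2)" for x y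
    using Re_cdot_vcnj_commute[of x y] by (simp add: f_def norm_mult)
  have fm: "case_prod f \<in> borel_measurable (lborel \<Otimes>\<^sub>M lborel)"
    unfolding f_def case_prod_beta lborel_prod
    by (simp, intro borel_measurable_continuous_onI continuous_intros)
  have int: "integrable (lborel \<Otimes>\<^sub>M lborel) (case_prod f)"
  proof (rule lborel_pair.Fubini_integrable[OF fm])
    show "integrable lborel (\<lambda>x. \<integral>y. norm (case_prod f (x, y)) \<partial>lborel)"
      using gaussian_integrable[OF b, where 'a="complex^'n"] by (simp add: nf)
    show "AE x in lborel. integrable lborel (\<lambda>y. case_prod f (x, y))"
    proof (intro always_eventually allI)
      fix x :: "complex^'n"
      have "f x y = ?G b x * (exp (cdot x (vcnj y) - a * of_real ((norm y)\<^sup>2)) * exp (cdot (- vcnj x) y))" for y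
        unfolding f_def cdot_minus_left cdot_commute[of "vcnj x" y] by (simp add: field_simps flip: exp_add)
      then show "integrable lborel (\<lambda>y. case_prod f (x, y))"
        using gauss_exp_integrable[OF a, of x "- vcnj x"] by simp
    qed
  qed
  have 1: "(\<integral>y. f x y \<partial>lborel) = gaussC TYPE('n) a * ?G (b + 1 / a) x" for x
  proof -
    have "(\<integral>y. f x y \<partial>lborel) = (\<integral>y. ?G b x * (exp (cdot x (vcnj y) - a * of_real ((norm y)\<^sup>2)) * exp (cdot (- vcnj x) y)) \<partial>lborel)"
      unfolding f_def cdot_minus_left cdot_commute[of "vcnj x"] by (simp add: field_simps flip: exp_add)
    also have "\<dots> = ?G b x * (gaussC TYPE('n) a * exp (cdot (- vcnj x) x / a))"
      by (subst integral_mult_right_zero) (simp only: gauss_exp_integral[OF a])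
    also have "\<dots> = gaussC TYPE('n) a * ?G (b + 1 / a) x"
    proof -
      have "- (of_real b + 1 / a) * of_real ((norm x)\<^sup>2) = - of_real b * of_real ((norm x)\<^sup>2) + cdot (- vcnj x) x / a"
        unfolding cdot_minus_left cdot_commute[of "vcnj x"] cdot_vcnj_self by (simp add: algebra_simps)
      then show ?thesis by (simp only: exp_add mult_ac)
    qed
    finally show ?thesis .
  qed
  have 2: "(\<integral>x. f x y \<partial>lborel) = gaussC TYPE('n) b * ?G (a + 1 / of_real b) y" for y
  proof -
    have b': "Re (of_real b) > 0" using b by simp
    have "(\<integral>x. f x y \<partial>lborel) = (\<integral>x. ?G a y * (exp (cdot (- y) (vcnj x) - of_real b * of_real ((norm x)\<^sup>2)) * exp (cdot (vcnj y) x)) \<partial>lborel)"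
      unfolding f_def cdot_minus_left cdot_commute[of "vcnj y"] by (simp add: field_simps flip: exp_add)
    also have "\<dots> = ?G a y * (gaussC TYPE('n) b * exp (cdot (vcnj y) (- y) / b))"
      by (subst integral_mult_right_zero) (simp only: gauss_exp_integral[OF b'])
    also have "\<dots> = gaussC TYPE('n) b * ?G (a + 1 / of_real b) y"
    proof -
      have "- (a + 1 / of_real b) * of_real ((norm y)\<^sup>2) = - a * of_real ((norm y)\<^sup>2) + cdot (vcnj y) (- y) / of_real b"
        unfolding cdot_commute[of "vcnj y"] cdot_minus_left cdot_vcnj_self by (simp add: algebra_simps)
      then show ?thesis by (simp only: exp_add mult_ac)
    qed
    finally show ?thesis .
  qed
  have "gaussC TYPE('n) a * gaussC TYPE('n) (of_real b + 1 / a) = (\<integral>x. \<integral>y. f x y \<partial>lborel \<partial>lborel)"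
    unfolding 1 by (simp add: gaussC_def)
  also have "\<dots> = (\<integral>y. \<integral>x. f x y \<partial>lborel \<partial>lborel)"
    by (rule lborel_pair.Fubini_integral[OF int, symmetric])
  also have "\<dots> = gaussC TYPE('n) (of_real b) * gaussC TYPE('n) (a + 1 / of_real b)"
    unfolding 2 by (simp add: gaussC_def)
  finally show ?thesis .
qed

text \<open>If N(a) = 0, the inversion formula gives N(a + t) = 0 for all t > 0, hence N(1 + a/t) = 0 by scaling,
  which contradicts N(1) > 0 as t tends to infinity.\<close>

lemma gaussC_nonzero:
  assumes a: "Re a > 0"
  shows "gaussC TYPE('n::finite) a \<noteq> 0"
proof
  assume 0: "gaussC TYPE('n) a = 0"
  have z: "gaussC TYPE('n) (a + of_real t) = 0" if "t > 0" for t
  proof -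
    \<comment> \<open>Inversion is applied with b = 1/t, so that a + 1/b = a + t; the other factor
      N(1/t) is positive and can be cancelled.\<close>
    have "1/t > 0" using that by simp
    then obtain r where "r > 0" "gaussC TYPE('n) (of_real (1/t)) = of_real r"
      by (rule gaussC_of_real_pos)
    then show ?thesis
      using gaussC_inversion[OF a, of "1/t", where 'n='n] that 0 by simp
  qed
  have z1: "gaussC TYPE('n) (1 + a / of_real t) = 0" if "t > 0" for t
  proof -
    let ?f = "\<lambda>y::complex^'n. exp (- (1 + a / of_real t) * of_real ((norm y)\<^sup>2)) :: complex"
    have "Re (1 + a / of_real t) > 0" using a that by (simp add: add_pos_pos)
    from gauss_exp_integrable[OF this, of "0::complex^'n" 0] have "integrable lborel ?f"
      by (simp add: algebra_simps)
    from has_bochner_integral_lborel_vec_smult[OF this, of "of_real (sqrt t)"] that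
    have "(\<integral>y. ?f (of_real (sqrt t) *s y) \<partial>lborel) = ((1 / sqrt t) ^ DIM(complex^'n)) *\<^sub>R gaussC TYPE('n) (1 + a / of_real t)"
      by (simp add: gaussC_def has_bochner_integral_iff)
    moreover have "?f (of_real (sqrt t) *s y) = exp (- (a + of_real t) * of_real ((norm y)\<^sup>2))" for y
    proof -
      have nn: "(norm (of_real (sqrt t) *s y))\<^sup>2 = t * (norm y)\<^sup>2"
        using that by (simp add: norm_vec_smult power_mult_distrib)
      have "- (1 + a / of_real t) * of_real ((norm (of_real (sqrt t) *s y))\<^sup>2) = - (a + of_real t) * of_real ((norm y)\<^sup>2)"
        unfolding nn using that by (simp add: field_simps)
      then show ?thesis by (simp only:)
    qed
    ultimately show ?thesis using z[OF that] that by (simp add: gaussC_def)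
  qed
  have "(\<lambda>k. gaussC TYPE('n) (1 + a / of_real (real (Suc k)))) \<longlonglongrightarrow> gaussC TYPE('n) 1"
    unfolding gaussC_def
  \<comment> \<open>Since Re a > 0, all the integrands are dominated by exp(-|y|^2), uniformly in
    k.\<close>
  proof (rule integral_dominated_convergence[where w="\<lambda>y. exp (- 1 * (norm y)\<^sup>2)"])
    show "integrable lborel (\<lambda>y::complex^'n. exp (- 1 * (norm y)\<^sup>2))" by (rule gaussian_integrable) simp
    have "(\<lambda>k. a / of_real (real (Suc k))) \<longlonglongrightarrow> 0"
    proof -
      have "(\<lambda>k. a * of_real (inverse (real (Suc k)))) \<longlonglongrightarrow> a * of_real 0"
        by (intro tendsto_intros LIMSEQ_inverse_real_of_nat)
      then show ?thesis by (simp add: divide_inverse)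
    qed
    from tendsto_add[OF tendsto_const[of 1] this]
    have "(\<lambda>k. 1 + a / of_real (real (Suc k))) \<longlonglongrightarrow> 1" by simp
    then show "AE y::complex^'n in lborel. (\<lambda>k. exp (- (1 + a / of_real (real (Suc k))) * of_real ((norm y)\<^sup>2))) \<longlonglongrightarrow> exp (- 1 * of_real ((norm y)\<^sup>2) :: complex)"
      by (intro always_eventually allI tendsto_intros)
    show "AE y::complex^'n in lborel. norm (exp (- (1 + a / of_real (real (Suc k))) * of_real ((norm y)\<^sup>2))) \<le> exp (- 1 * (norm y)\<^sup>2)" for k
      using a by (intro always_eventually allI) (simp add: algebra_simps del: of_nat_Suc)
  qed auto
  then have "gaussC TYPE('n) 1 = 0"
    using z1[of "real (Suc _)"] by (simp add: LIMSEQ_const_iff del: of_nat_Suc)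
  moreover obtain r where "r > 0" "gaussC TYPE('n) (of_real 1) = of_real r"
    using gaussC_of_real_pos[of 1, where 'n='n] by auto
  ultimately show False by simp
qed

section \<open>The weighted inner product, coherent states and the projection\<close>

lemma mult_le_sum_squares:
  fixes s t :: real
  assumes "s \<ge> 0" "t \<ge> 0"
  shows "s * t \<le> s\<^sup>2 + t\<^sup>2"
  using sum_squares_bound[of s t] mult_nonneg_nonneg[OF assms] by linarith

lemma integrable_L2w_inner:
  fixes u v :: "complex^'n::finite \<Rightarrow> complex"
  assumes "u \<in> L2w" "v \<in> L2w"
  shows "integrable lborel (\<lambda>x. u x * cnj (v x) * complex_of_real (exp (- 2 * Phi0 x)))"
proof (rule Bochner_Integration.integrable_bound)
  have [measurable]: "u \<in> borel_measurable borel" "v \<in> borel_measurable borel"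
    using assms by (auto simp: L2w_def)
  show "integrable lborel (\<lambda>x. (cmod (u x))\<^sup>2 * exp (- 2 * Phi0 x) + (cmod (v x))\<^sup>2 * exp (- 2 * Phi0 x))"
    using assms by (auto simp: L2w_def)
  show "(\<lambda>x. u x * cnj (v x) * complex_of_real (exp (- 2 * Phi0 x))) \<in> borel_measurable lborel"
    by measurable
  show "AE x in lborel. norm (u x * cnj (v x) * complex_of_real (exp (- 2 * Phi0 x)))
     \<le> norm ((cmod (u x))\<^sup>2 * exp (- 2 * Phi0 x) + (cmod (v x))\<^sup>2 * exp (- 2 * Phi0 x))"
    using mult_le_sum_squares[of "cmod (u _)" "cmod (v _)"]
    by (intro always_eventually allI) (simp add: norm_mult flip: distrib_right)
qed

text \<open>The reproducing kernel of H at w, up to normalization: pairing with it evaluates at w,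
  times N(1/2).\<close>

definition coherent :: "complex^'n::finite \<Rightarrow> complex^'n \<Rightarrow> complex" where
  "coherent w = (\<lambda>x. exp (cdot (vcnj w) x / 2))"

lemma coherent_alt: "coherent w = (\<lambda>x. exp (cdot ((1/2) *s vcnj w) x))"
  by (simp add: coherent_def cdot_linear)

lemma cnj_coherent: "cnj (coherent w x) = coherent x w"
  by (simp add: coherent_def exp_cnj cnj_cdot cdot_commute)

text \<open>Squaring doubles the quadratic rate b, while the weight is exp(-|y|^2/2); this gives the
  threshold 1/4. It is the bound on Re \<lambda>, which puts coherent states into the domain of the
  operator.\<close>

lemma L2wI:
  fixes f :: "complex^'n::finite \<Rightarrow> complex"
  assumes "continuous_on UNIV f" "b < 1/4" "\<And>y. cmod (f y) \<le> K * exp (b * (norm y)\<^sup>2 + C * norm y)"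
  shows "f \<in> L2w"
proof -
  have "integrable lborel (\<lambda>y. complex_of_real ((cmod (f y))\<^sup>2 * exp (- 2 * Phi0 y)))"
  proof (rule gauss_integrable_bound)
    show "continuous_on UNIV (\<lambda>y. complex_of_real ((cmod (f y))\<^sup>2 * exp (- 2 * Phi0 y)))"
      by (intro continuous_intros assms)
    show "1/2 - 2 * b > 0" using assms by simp
    fix y
    have "(cmod (f y))\<^sup>2 \<le> (K * exp (b * (norm y)\<^sup>2 + C * norm y))\<^sup>2"
      by (intro power_mono assms) simp
    then have "(cmod (f y))\<^sup>2 * exp (- 2 * Phi0 y) \<le> (K * exp (b * (norm y)\<^sup>2 + C * norm y))\<^sup>2 * exp (- 2 * Phi0 y)"
      by (rule mult_right_mono) simp
    also have "\<dots> = K\<^sup>2 * exp (- (1/2 - 2 * b) * (norm y)\<^sup>2 + (2 * C) * norm y)"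
      by (simp add: Phi0_def power_mult_distrib algebra_simps flip: exp_add exp_double)
    finally show "cmod (complex_of_real ((cmod (f y))\<^sup>2 * exp (- 2 * Phi0 y)))
        \<le> K\<^sup>2 * exp (- (1/2 - 2 * b) * (norm y)\<^sup>2 + (2 * C) * norm y)"
      unfolding norm_of_real by (subst abs_of_nonneg) auto
  qed
  then show ?thesis
    unfolding L2w_def complex_of_real_integrable_eq using assms(1) by (auto simp: borel_measurable_continuous_onI)
qed

lemma cmod_exp_cdot_le: "cmod (exp (cdot p x)) \<le> exp (norm p * norm (x::complex^'n::finite))"
  using order_trans[OF complex_Re_le_cmod norm_cdot_le[of p x]] by simp

lemma scaled_exp_cdot_H_Phi0: "(\<lambda>x. k * exp (cdot p x)) \<in> H_Phi0"
proof -
  have "holo_Cn (\<lambda>x. k * exp (cdot p x))"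
    by (intro holo_Cn_mult holo_Cn_const holo_Cn_exp holo_Cn_cdot)
  moreover have "(\<lambda>x. k * exp (cdot p x)) \<in> L2w"
  proof (rule L2wI[where b=0 and K="cmod k" and C="norm p"])
    show "continuous_on UNIV (\<lambda>x. k * exp (cdot p x))"
      by (intro continuous_intros)
    show "cmod (k * exp (cdot p y)) \<le> cmod k * exp (0 * (norm y)\<^sup>2 + norm p * norm y)" for y
      using mult_left_mono[OF cmod_exp_cdot_le[of p y] norm_ge_zero[of k]] by (simp add: norm_mult)
  qed simp
  ultimately show ?thesis by (simp add: H_Phi0_def)
qed

lemma coherent_H_Phi0: "coherent w \<in> H_Phi0"
  unfolding coherent_alt using scaled_exp_cdot_H_Phi0[of 1] by simp

text \<open>This is \<open>gauss_shifted\<close> with a = 1/2 and q = x/2, for which q/a =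
  x.\<close>

lemma reproducing:
  fixes g :: "complex^'n::finite \<Rightarrow> complex"
  assumes g: "g \<in> H_Phi0"
  shows "L2w_inner g (coherent x) = gaussC TYPE('n) (1/2) * g x"
proof -
  have e: "g y * cnj (coherent x y) * complex_of_real (exp (- 2 * Phi0 y))
      = exp (cdot ((1/2) *s x) (vcnj y) - (1/2) * of_real ((norm y)\<^sup>2)) * g y" for y
  proof -
    have "cdot ((1/2) *s x) (vcnj y) - (1/2) * of_real ((norm y)\<^sup>2) = cdot (vcnj y) x / 2 + of_real (- 2 * Phi0 y)"
      by (simp add: Phi0_def cdot_linear cdot_commute[of "vcnj y"])
    then show ?thesis
      unfolding cnj_coherent by (simp only: coherent_def exp_of_real[symmetric] exp_add mult_ac)
  qed
  have "integrable lborel (\<lambda>y. g y * cnj (coherent x y) * complex_of_real (exp (- 2 * Phi0 y)))"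
    by (rule integrable_L2w_inner) (use g coherent_H_Phi0[of x] in \<open>auto simp: H_Phi0_def\<close>)
  then show ?thesis
    unfolding L2w_inner_def e
    by (subst gauss_shifted) (use g in \<open>auto simp: H_Phi0_def vector_smult_assoc\<close>)
qed

text \<open>Fubini against an arbitrary g in H is justified by Schur's test: with the weights included, the
  kernel has modulus exp(-|x - y|^2 / 4). No completeness of H is needed, since h is given.\<close>

lemma Pi_Phi0_eqI:
  fixes v h :: "complex^'n::finite \<Rightarrow> complex"
  assumes v: "v \<in> L2w" and h: "h \<in> H_Phi0"
    and rep: "\<And>x. L2w_inner v (coherent x) = gaussC TYPE('n) (1/2) * h x"
  shows "Pi_Phi0 v = h"
proof -
  have N0: "gaussC TYPE('n) (1/2) \<noteq> 0" by (rule gaussC_nonzero) simp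
  have inner_diff: "L2w_inner (\<lambda>x. v x - h' x) g = L2w_inner v g - L2w_inner h' g"
    if "h' \<in> H_Phi0" "g \<in> H_Phi0" for h' g
  proof -
    have "v \<in> L2w" "h' \<in> L2w" "g \<in> L2w"
      using that v by (auto simp: H_Phi0_def)
    then show ?thesis
      using Bochner_Integration.integral_diff[OF integrable_L2w_inner[of v g] integrable_L2w_inner[of h' g]]
      unfolding L2w_inner_def by (simp add: left_diff_distrib)
  qed
  have orth: "L2w_inner v g = L2w_inner h g" if g: "g \<in> H_Phi0" for g
  proof -
    have [measurable]: "v \<in> borel_measurable borel" "g \<in> borel_measurable borel"
      using v g by (auto simp: L2w_def H_Phi0_def)
    let ?w = "\<lambda>x::complex^'n. exp (- 2 * Phi0 x)"
    define f where "f = (\<lambda>x y::complex^'n. v y * cnj (coherent x y) * of_real (?w y) * cnj (g x) * of_real (?w x))"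
    define k where "k = (\<lambda>z::complex^'n. exp (- (1/4) * (norm z)\<^sup>2))"
    have k: "integrable lborel k" unfolding k_def by (rule gaussian_integrable) simp
    have kshift: "has_bochner_integral lborel (\<lambda>x. k (x - y)) (\<integral>z. k z \<partial>lborel)" for y
      using has_bochner_integral_lborel_shift[OF k, of "- y"] by simp
    have ksym: "k (x - y) = k (y - x)" for x y by (simp add: k_def norm_minus_commute)
    have km[measurable]: "k \<in> borel_measurable borel" unfolding k_def by measurable
    have cm[measurable]: "(\<lambda>p. coherent (fst p) (snd p)) \<in> borel_measurable (borel \<Otimes>\<^sub>M borel)"
      unfolding borel_prod coherent_def by (intro borel_measurable_continuous_onI continuous_intros) auto
    have fm: "case_prod f \<in> borel_measurable (lborel \<Otimes>\<^sub>M lborel)"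
      unfolding f_def case_prod_beta by measurable
    define V where "V = (\<lambda>y. (cmod (v y))\<^sup>2 * ?w y)"
    define G where "G = (\<lambda>y. (cmod (g y))\<^sup>2 * ?w y)"
    have V: "integrable lborel V" and G: "integrable lborel G"
      using v g by (auto simp: V_def G_def L2w_def H_Phi0_def)
    have [measurable]: "V \<in> borel_measurable borel" "G \<in> borel_measurable borel"
      using V G by auto
    have bound: "norm (f x y) \<le> k (x - y) * V y + k (x - y) * G x" for x y
    proof -
      have "2 * Re (cdot x (vcnj y)) = (norm x)\<^sup>2 + (norm y)\<^sup>2 - (norm (x - y))\<^sup>2"
        using norm_add_sqr_cdot[of x "- y"] by (simp add: vcnj_def cdot_def sum_negf)
      then have "Re (cdot (vcnj x) y / 2) - Phi0 y - Phi0 x = - (1/4) * (norm (x - y))\<^sup>2"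
        using Re_cdot_vcnj_commute[of x y] cdot_commute[of "vcnj x" y] by (simp add: Phi0_def)
      \<comment> \<open>Each weight is split in two: exp(-Phi0) from either variable turns the
        kernel into k(x - y), and the other half stays with v and g, whose squares are then
        integrable.\<close>
      then have "exp (Re (cdot (vcnj x) y / 2)) * ?w y * ?w x = k (x - y) * (exp (- Phi0 y) * exp (- Phi0 x))"
        unfolding k_def by (simp flip: exp_add)
      then have "norm (f x y) = k (x - y) * ((cmod (v y) * exp (- Phi0 y)) * (cmod (g x) * exp (- Phi0 x)))"
        unfolding f_def coherent_def by (simp add: norm_mult)
      also have "\<dots> \<le> k (x - y) * ((cmod (v y) * exp (- Phi0 y))\<^sup>2 + (cmod (g x) * exp (- Phi0 x))\<^sup>2)"
      proof (rule mult_left_mono)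
        show "cmod (v y) * exp (- Phi0 y) * (cmod (g x) * exp (- Phi0 x))
          \<le> (cmod (v y) * exp (- Phi0 y))\<^sup>2 + (cmod (g x) * exp (- Phi0 x))\<^sup>2"
          by (rule mult_le_sum_squares) auto
      qed (auto simp: k_def)
      also have "\<dots> = k (x - y) * V y + k (x - y) * G x"
        by (simp add: V_def G_def power_mult_distrib distrib_left flip: exp_double)
      finally show ?thesis .
    qed
    \<comment> \<open>V depends on y, so x has to be integrated first; the variables are swapped
      back afterwards.\<close>
    have "integrable (lborel \<Otimes>\<^sub>M lborel) (\<lambda>(x, y). k (x - y) * V y)"
    proof -
      have "integrable (lborel \<Otimes>\<^sub>M lborel) (\<lambda>(y, x). k (x - y) * V y)"
      proof (rule lborel_pair.Fubini_integrable)
        show "integrable lborel (\<lambda>y. \<integral>x. norm (case (y, x) of (y, x) \<Rightarrow> k (x - y) * V y) \<partial>lborel)"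
          using kshift V by (simp add: has_bochner_integral_iff V_def abs_mult k_def)
        show "AE y in lborel. integrable lborel (\<lambda>x. case (y, x) of (y, x) \<Rightarrow> k (x - y) * V y)"
          using kshift by (auto simp: has_bochner_integral_iff)
      qed measurable
      from lborel_pair.integrable_product_swap[OF this] show ?thesis by (simp add: case_prod_beta)
    qed
    moreover have "integrable (lborel \<Otimes>\<^sub>M lborel) (\<lambda>(x, y). k (x - y) * G x)"
      proof (rule lborel_pair.Fubini_integrable)
        show "integrable lborel (\<lambda>x. \<integral>y. norm (case (x, y) of (x, y) \<Rightarrow> k (x - y) * G x) \<partial>lborel)"
          using kshift G unfolding ksym[of x] by (simp add: has_bochner_integral_iff G_def abs_mult k_def norm_minus_commute)
        show "AE x in lborel. integrable lborel (\<lambda>y. case (x, y) of (x, y) \<Rightarrow> k (x - y) * G x)"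
          using kshift by (auto simp: has_bochner_integral_iff ksym)
      qed measurable
    ultimately have int: "integrable (lborel \<Otimes>\<^sub>M lborel) (case_prod f)"
    proof (intro Bochner_Integration.integrable_bound[OF Bochner_Integration.integrable_add fm always_eventually])
      show "\<forall>p. norm (case_prod f p) \<le> norm ((case p of (x, y) \<Rightarrow> k (x - y) * V y) + (case p of (x, y) \<Rightarrow> k (x - y) * G x))"
        using order_trans[OF bound abs_ge_self] by auto
    qed
    have "gaussC TYPE('n) (1/2) * L2w_inner h g = (\<integral>x. (gaussC TYPE('n) (1/2) * h x) * cnj (g x) * of_real (?w x) \<partial>lborel)"
      unfolding L2w_inner_def by (simp add: mult.assoc)
    also have "\<dots> = (\<integral>x. \<integral>y. f x y \<partial>lborel \<partial>lborel)"
      unfolding rep[symmetric] L2w_inner_def f_def by simp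
    also have "\<dots> = (\<integral>y. \<integral>x. f x y \<partial>lborel \<partial>lborel)"
      by (rule lborel_pair.Fubini_integral[OF int, symmetric])
    \<comment> \<open>With the order exchanged, the kernel acts on g instead of v. As g is
      holomorphic, the reproducing property turns the inner integral into the conjugate of N(1/2)
      g(y).\<close>
    also have "\<dots> = (\<integral>y. v y * of_real (?w y) * cnj (L2w_inner g (coherent y)) \<partial>lborel)"
    proof (rule Bochner_Integration.integral_cong[OF refl])
      fix y
      have "(\<integral>x. f x y \<partial>lborel) = (\<integral>x. v y * of_real (?w y) * cnj (g x * cnj (coherent y x) * of_real (?w x)) \<partial>lborel)"
        unfolding f_def cnj_coherent[of _ y] by (simp add: cnj_coherent mult_ac)
      also have "\<dots> = v y * of_real (?w y) * cnj (L2w_inner g (coherent y))"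
        unfolding L2w_inner_def by (simp only: integral_mult_right_zero Bochner_Integration.integral_cnj)
      finally show "(\<integral>x. f x y \<partial>lborel) = v y * of_real (?w y) * cnj (L2w_inner g (coherent y))" .
    qed
    also have "\<dots> = cnj (gaussC TYPE('n) (1/2)) * L2w_inner v g"
      unfolding reproducing[OF g] unfolding L2w_inner_def by (simp add: mult_ac flip: integral_mult_right_zero)
    \<comment> \<open>N(1/2) is real, so the same nonzero factor stands on both sides and
      cancels.\<close>
    also have "cnj (gaussC TYPE('n) (1/2)) = gaussC TYPE('n) (1/2)"
      unfolding gaussC_def by (simp add: exp_cnj flip: Bochner_Integration.integral_cnj)
    finally show ?thesis using N0 by simp
  qed
  show ?thesis
    unfolding Pi_Phi0_def
  proof (rule the_equality)
    show "h \<in> H_Phi0 \<and> (\<forall>g\<in>H_Phi0. L2w_inner (\<lambda>x. v x - h x) g = 0)"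
      using h orth inner_diff by simp
    fix h' assume h': "h' \<in> H_Phi0 \<and> (\<forall>g\<in>H_Phi0. L2w_inner (\<lambda>x. v x - h' x) g = 0)"
    show "h' = h"
    proof
      fix x
      \<comment> \<open>Uniqueness is pointwise: orthogonality tested on the coherent state at x
        determines the value at x.\<close>
      have "L2w_inner v (coherent x) = L2w_inner h' (coherent x)"
        using h' inner_diff coherent_H_Phi0[of x] by fastforce
      then show "h' x = h x"
        using rep[of x] reproducing[of h' x] h' N0 by simp
    qed
  qed
qed

lemma Pi_Phi0_id: "u \<in> H_Phi0 \<Longrightarrow> Pi_Phi0 u = u"
  by (rule Pi_Phi0_eqI) (auto simp: reproducing, auto simp: H_Phi0_def)

section \<open>Bounded quadratics, norms of exponentials, essential boundedness\<close>

lemma quadratic_bounded_above_iff: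
  fixes p :: "complex^'n::finite"
  shows "(\<exists>B. \<forall>w. \<alpha> * (norm w)\<^sup>2 + Re (cdot p (vcnj w)) \<le> B) \<longleftrightarrow> \<alpha> < 0 \<or> (\<alpha> = 0 \<and> p = 0)"
    (is "?L \<longleftrightarrow> ?R")
proof
  assume ?L
  then obtain B where B: "\<And>w. \<alpha> * (norm w)\<^sup>2 + Re (cdot p (vcnj w)) \<le> B" by blast
  \<comment> \<open>Adding the bounds at w and -w cancels the linear term.\<close>
  have B': "\<alpha> * (norm w)\<^sup>2 \<le> B" for w :: "complex^'n"
    using B[of w] B[of "- 1 *s w", unfolded norm_vec_smult vcnj_smult cdot_smult_right] by simp
  have "\<alpha> \<le> 0"
  proof (rule ccontr)
    assume "\<not> \<alpha> \<le> 0"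
    define r where "r = sqrt ((\<bar>B\<bar> + 1) / \<alpha>)"
    have "\<alpha> * r\<^sup>2 = \<bar>B\<bar> + 1" using \<open>\<not> \<alpha> \<le> 0\<close> by (simp add: r_def)
    then show False
      \<comment> \<open>A vector of length r along an arbitrary coordinate; r was chosen so that the
        quadratic term equals |B| + 1 > B.\<close>
      using B'[of "of_real r *s axis undefined 1"] by (simp add: norm_vec_smult norm_axis_1)
  qed
  moreover have "p = 0" if "\<alpha> = 0"
  proof (rule ccontr)
    assume "p \<noteq> 0"
    define r where "r = (\<bar>B\<bar> + 1) / (norm p)\<^sup>2"
    have "r * (norm p)\<^sup>2 = \<bar>B\<bar> + 1" using \<open>p \<noteq> 0\<close> by (simp add: r_def)
    moreover have "r * (norm p)\<^sup>2 \<le> B"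
      using B[of "of_real r *s p"] that
      by (simp add: vcnj_smult cdot_smult_right cdot_vcnj_self flip: of_real_power)
    ultimately show False by linarith
  qed
  ultimately show ?R by linarith
next
  assume ?R
  then show ?L
  proof
    assume a: "\<alpha> < 0"
    show ?L
    proof (intro exI allI)
      fix w
      have "Re (cdot p (vcnj w)) \<le> norm p * norm w"
        using order_trans[OF complex_Re_le_cmod norm_cdot_le[of p "vcnj w"]] by simp
      moreover have "\<alpha> * (norm w)\<^sup>2 + norm p * norm w \<le> (norm p)\<^sup>2 / (- 4 * \<alpha>)"
      proof -
        \<comment> \<open>Completing the square: \<alpha> t^2 + |p| t is largest at t =
          -|p|/(2\<alpha>).\<close>
        have "0 \<le> (2 * \<alpha> * norm w + norm p)\<^sup>2 / (- 4 * \<alpha>)" using a by (intro divide_nonneg_nonneg) auto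
        also have "\<dots> = (norm p)\<^sup>2 / (- 4 * \<alpha>) - (\<alpha> * (norm w)\<^sup>2 + norm p * norm w)"
          using a by (simp add: field_simps power2_eq_square)
        finally show ?thesis by simp
      qed
      ultimately show "\<alpha> * (norm w)\<^sup>2 + Re (cdot p (vcnj w)) \<le> (norm p)\<^sup>2 / (- 4 * \<alpha>)" by linarith
    qed
  qed auto
qed

text \<open>The exponential is itself the coherent state at 2 conj p, so its squared norm is an
  evaluation at that point, where p \<cdot> (2 conj p) = 2|p|^2.\<close>

lemma L2w_norm_exp_cdot:
  fixes p :: "complex^'n::finite"
  assumes r: "r > 0" "gaussC TYPE('n) (1/2) = of_real r"
  shows "L2w_norm (\<lambda>x. k * exp (cdot p x)) = cmod k * sqrt r * exp ((norm p)\<^sup>2)"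
proof -
  let ?f = "\<lambda>x. k * exp (cdot p x)"
  have coh: "coherent (2 *s vcnj p) = (\<lambda>x. exp (cdot p x))"
    by (simp add: coherent_def vcnj_linear cdot_linear)
  have "complex_of_real (\<integral>x. (cmod (?f x))\<^sup>2 * exp (- 2 * Phi0 x) \<partial>lborel) = L2w_inner ?f ?f"
    unfolding L2w_inner_def integral_complex_of_real[symmetric]
    by (simp only: of_real_mult complex_norm_square)
  also have "\<dots> = (\<integral>x. cnj k * (?f x * cnj (coherent (2 *s vcnj p) x) * complex_of_real (exp (- 2 * Phi0 x))) \<partial>lborel)"
    unfolding L2w_inner_def coh by (simp add: mult_ac)
  also have "\<dots> = cnj k * L2w_inner ?f (coherent (2 *s vcnj p))"
    unfolding L2w_inner_def by (rule integral_mult_right_zero)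
  also have "\<dots> = cnj k * (of_real r * (k * exp (2 * of_real ((norm p)\<^sup>2))))"
    unfolding reproducing[OF scaled_exp_cdot_H_Phi0] r(2) by (simp add: cdot_smult_right cdot_vcnj_self)
  also have "\<dots> = of_real ((cmod k)\<^sup>2 * r * (exp ((norm p)\<^sup>2))\<^sup>2)"
  proof -
    have "exp (2 * complex_of_real ((norm p)\<^sup>2)) = of_real ((exp ((norm p)\<^sup>2))\<^sup>2)"
      unfolding exp_double[symmetric] exp_of_real[symmetric] by simp
    then show ?thesis
      by (simp only: of_real_mult complex_norm_square mult_ac)
  qed
  finally have "(\<integral>x. (cmod (?f x))\<^sup>2 * exp (- 2 * Phi0 x) \<partial>lborel) = (cmod k)\<^sup>2 * r * (exp ((norm p)\<^sup>2))\<^sup>2"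
    unfolding of_real_eq_iff .
  then show ?thesis
    unfolding L2w_norm_def by (simp add: real_sqrt_mult)
qed

text \<open>By continuity a value above C persists on a ball, which has positive measure.\<close>

lemma Linfty_iff_bounded:
  fixes f :: "complex^'n::finite \<Rightarrow> complex"
  assumes "continuous_on UNIV f"
  shows "Linfty_Lambda f \<longleftrightarrow> (\<exists>C. \<forall>x. cmod (f x) \<le> C)"
proof
  assume "Linfty_Lambda f"
  then obtain C where C: "AE x in lborel. cmod (f x) \<le> C" by (auto simp: Linfty_Lambda_def)
  have "cmod (f x) \<le> C" for x
  proof (rule ccontr)
    assume x: "\<not> cmod (f x) \<le> C"
    have "open {y. C < cmod (f y)}"
      by (intro open_Collect_less continuous_intros assms)
    moreover have "x \<in> {y. C < cmod (f y)}" using x by simp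
    ultimately obtain e where e: "e > 0" "ball x e \<subseteq> {y. C < cmod (f y)}"
      using open_contains_ball by blast
    have "AE y in lborel. y \<notin> ball x e"
      using C
    proof eventually_elim
      fix y assume "cmod (f y) \<le> C"
      then have "y \<notin> {y. C < cmod (f y)}" by simp
      then show "y \<notin> ball x e" using e(2) by blast
    qed
    then have "emeasure lborel (ball x e) = 0"
      by (subst (asm) AE_iff_measurable[of "ball x e"]) auto
    then have "measure lborel (ball x e) = 0" by (simp add: measure_def)
    then show False using e(1) by simp
  qed
  then show "\<exists>C. \<forall>x. cmod (f x) \<le> C" by blast
qed (auto simp: Linfty_Lambda_def)

text \<open>The Gaussian constant of the weight multiplied by exp(l|y|^2), relative to that of the
  weight itself; for Re l < 1/2 it is (1 - 2l)^(-n).\<close>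

definition Top_factor :: "'n::finite itself \<Rightarrow> complex \<Rightarrow> complex" where
  "Top_factor _ l = gaussC TYPE('n) (1/2 - l) / gaussC TYPE('n) (1/2)"

section \<open>The Toeplitz operator as a weighted composition operator\<close>

context
  fixes c d :: "complex ^ 'n::finite" and lam :: complex
    and Q :: "complex ^ 'n \<Rightarrow> complex"
  assumes lam: "Re lam < 1/4"
    and Q: "\<And>x. Q x = lam * complex_of_real ((norm x)\<^sup>2) + cdot (vcnj c) x / 2 - cdot d (vcnj x) / 2"
begin

lemma mu_nonzero: "1 - 2 * lam \<noteq> 0" "1 - lam \<noteq> 0"
  using lam by (auto simp: complex_eq_iff)

lemma Top_factor_nonzero: "Top_factor TYPE('n) lam \<noteq> 0"
  unfolding Top_factor_def using lam by (simp add: gaussC_nonzero)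

text \<open>The point y is q/a in \<open>gauss_shifted\<close> with q = (x - d)/2 and a = 1/2 -
  \<lambda>: the antiholomorphic part of Q joins the kernel and moves the point, while the
  holomorphic part stays with u.\<close>

definition Top_explicit :: "(complex^'n \<Rightarrow> complex) \<Rightarrow> complex^'n \<Rightarrow> complex" where
  "Top_explicit u x = (let y = (1 / (1 - 2 * lam)) *s (x - d)
     in Top_factor TYPE('n) lam * (exp (cdot ((1/2) *s vcnj c) y) * u y))"

lemma holo_Top_explicit:
  assumes "holo_Cn u"
  shows "holo_Cn (Top_explicit u)"
proof -
  let ?F = "\<lambda>y. Top_factor TYPE('n) lam * (exp (cdot ((1/2) *s vcnj c) y) * u y)"
  have "holo_Cn ?F"
    by (intro holo_Cn_mult holo_Cn_const holo_Cn_exp holo_Cn_cdot assms)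
  note holo_Cn_affine[OF this, of "1 / (1 - 2 * lam)" "(- 1 / (1 - 2 * lam)) *s d"]
  moreover have "(1 / (1 - 2 * lam)) *s x + (- 1 / (1 - 2 * lam)) *s d = (1 / (1 - 2 * lam)) *s (x - d)" for x
    by (simp add: vec_eq_iff diff_divide_distrib)
  ultimately show ?thesis
    unfolding Top_explicit_def Let_def by simp
qed

text \<open>Pairing e^Q u with the kernel always produces the explicit formula. Membership in H is a
  hypothesis because it comes from different sources: the norm estimate in the upper bound, a direct
  check for coherent states.\<close>

lemma Top_eq_explicit:
  assumes u: "u \<in> Top_dom Q" and H: "Top_explicit u \<in> H_Phi0"
  shows "Top Q u = Top_explicit u"
proof -
  have uH: "u \<in> H_Phi0" and v: "(\<lambda>x. exp (Q x) * u x) \<in> L2w"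
    using u by (auto simp: Top_dom_def)
  have N0: "gaussC TYPE('n) (1/2) \<noteq> 0" by (rule gaussC_nonzero) simp
  have a: "1/2 - lam \<noteq> 0" using lam by (auto simp: complex_eq_iff)
  have "L2w_inner (\<lambda>x. exp (Q x) * u x) (coherent x) = gaussC TYPE('n) (1/2) * Top_explicit u x" for x
  proof -
    let ?F = "\<lambda>y. exp (cdot ((1/2) *s vcnj c) y) * u y"
    have e: "exp (Q y) * u y * cnj (coherent x y) * complex_of_real (exp (- 2 * Phi0 y))
      = exp (cdot ((1/2) *s (x - d)) (vcnj y) - (1/2 - lam) * of_real ((norm y)\<^sup>2)) * ?F y" for y
    proof -
      have "cdot ((1/2) *s (x - d)) (vcnj y) - (1/2 - lam) * of_real ((norm y)\<^sup>2) + cdot ((1/2) *s vcnj c) y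
        = Q y + cdot (vcnj y) x / 2 + of_real (- 2 * Phi0 y)"
        by (simp add: Q Phi0_def cdot_linear cdot_commute[of "vcnj y"] field_simps)
      note this[THEN arg_cong[where f=exp]]
      then show ?thesis
        unfolding cnj_coherent by (simp only: coherent_def exp_of_real[symmetric] exp_add mult_ac)
    qed
    have "integrable lborel (\<lambda>y. exp (Q y) * u y * cnj (coherent x y) * complex_of_real (exp (- 2 * Phi0 y)))"
      by (rule integrable_L2w_inner) (use v coherent_H_Phi0[of x] in \<open>auto simp: H_Phi0_def\<close>)
    then have int: "integrable lborel (\<lambda>y. exp (cdot ((1/2) *s (x - d)) (vcnj y) - (1/2 - lam) * of_real ((norm y)\<^sup>2)) * ?F y)"
      unfolding e .
    have F: "holo_Cn ?F"
      using uH by (intro holo_Cn_mult holo_Cn_exp holo_Cn_cdot) (auto simp: H_Phi0_def)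
    have y: "(1 / (1/2 - lam)) *s ((1/2) *s (x - d)) = (1 / (1 - 2 * lam)) *s (x - d)"
      using a mu_nonzero by (simp add: vec_eq_iff field_simps)
    have "L2w_inner (\<lambda>x. exp (Q x) * u x) (coherent x)
        = gaussC TYPE('n) (1/2 - lam) * ?F ((1 / (1 - 2 * lam)) *s (x - d))"
      unfolding L2w_inner_def e gauss_shifted[OF F a int] y ..
    also have "\<dots> = gaussC TYPE('n) (1/2) * Top_explicit u x"
      using N0 unfolding Top_explicit_def Let_def Top_factor_def by simp
    finally show ?thesis .
  qed
  then have "Pi_Phi0 (\<lambda>x. exp (Q x) * u x) = Top_explicit u"
    by (intro Pi_Phi0_eqI v H)
  then show ?thesis
    unfolding Top_def Pi_Phi0_id[OF uH] .
qed

section \<open>Upper bound by substitution\<close>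

lemma Top_bounded_if:
  assumes cond: "cmod (1 - 2 * lam) > 1 \<or> (cmod (1 - 2 * lam) = 1 \<and> c = cnj (1 - 2 * lam) *s d)"
  shows "Top_bounded Q"
proof -
  define m where "m = 1 - 2 * lam"
  have m0: "m \<noteq> 0" using mu_nonzero by (simp add: m_def)
  have "(1 - (cmod m)\<^sup>2) / 2 < 0 \<or> ((1 - (cmod m)\<^sup>2) / 2 = 0 \<and> c - cnj m *s d = 0)"
    using cond by (auto simp: m_def one_less_power)
  then obtain B where B: "\<And>y. (1 - (cmod m)\<^sup>2) / 2 * (norm y)\<^sup>2 + Re (cdot (c - cnj m *s d) (vcnj y)) \<le> B"
    unfolding quadratic_bounded_above_iff[symmetric] by blast
  \<comment> \<open>Under x = m y + d the exponent of the transformed integrand exceeds that of the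
    original weight by the quadratic bounded through B, minus |d|^2/2, which is dropped.\<close>
  have G: "Re (cdot (vcnj c) y) - 2 * Phi0 (m *s y + d) \<le> B - 2 * Phi0 y" for y
  proof -
    have "Re (cdot (cnj m *s d) (vcnj y)) = Re (cdot (m *s y) (vcnj d))"
      using Re_cdot_vcnj_commute[of "m *s y" d] by (simp add: vcnj_smult cdot_linear)
    moreover have "Re (cdot (vcnj c) y) = Re (cdot c (vcnj y))"
      using Re_cdot_vcnj_commute[of c y] by (simp add: cdot_commute)
    ultimately show ?thesis
      using B[of y] unfolding Phi0_def norm_add_sqr_cdot
      by (simp add: cdot_diff_left norm_vec_smult power_mult_distrib field_simps)
        (insert zero_le_power2[of "norm d"], linarith)
  qed
  define K where "K = (cmod (Top_factor TYPE('n) lam))\<^sup>2 * exp B"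
  \<comment> \<open>The Jacobian of y \<mapsto> m y + d, with the real dimension as
    exponent.\<close>
  define D where "D = cmod m ^ DIM(complex^'n)"
  have "L2w_norm (Top Q u) \<le> sqrt (D * K) * L2w_norm u" if u: "u \<in> Top_dom Q" for u
  proof -
    have uH: "u \<in> H_Phi0" using u by (auto simp: Top_dom_def)
    then have hol: "holo_Cn u" and um[measurable]: "u \<in> borel_measurable borel"
      and ui: "integrable lborel (\<lambda>x. (cmod (u x))\<^sup>2 * exp (- 2 * Phi0 x))"
      by (auto simp: H_Phi0_def L2w_def)
    let ?F = "\<lambda>y. Top_factor TYPE('n) lam * (exp (cdot ((1/2) *s vcnj c) y) * u y)"
    let ?f = "\<lambda>y. (cmod (?F y))\<^sup>2 * exp (- 2 * Phi0 (m *s y + d))"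
    have hF: "holo_Cn ?F"
      by (intro holo_Cn_mult holo_Cn_const holo_Cn_exp holo_Cn_cdot hol)
    have [measurable]: "?F \<in> borel_measurable borel" by (rule holo_Cn_measurable[OF hF])
    have fle: "?f y \<le> K * ((cmod (u y))\<^sup>2 * exp (- 2 * Phi0 y))" for y
    proof -
      have "?f y = (cmod (Top_factor TYPE('n) lam))\<^sup>2 * (cmod (u y))\<^sup>2 * exp (Re (cdot (vcnj c) y) - 2 * Phi0 (m *s y + d))"
        by (simp add: norm_mult power_mult_distrib cdot_smult_left exp_diff exp_minus field_simps flip: exp_double)
      also have "\<dots> \<le> (cmod (Top_factor TYPE('n) lam))\<^sup>2 * (cmod (u y))\<^sup>2 * exp (B - 2 * Phi0 y)"
        by (intro mult_left_mono) (use G[of y] in auto)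
      also have "\<dots> = K * ((cmod (u y))\<^sup>2 * exp (- 2 * Phi0 y))"
        by (simp add: K_def exp_diff exp_minus field_simps)
      finally show ?thesis .
    qed
    have fi: "integrable lborel ?f"
    proof (rule Bochner_Integration.integrable_bound)
      show "integrable lborel (\<lambda>y. K * ((cmod (u y))\<^sup>2 * exp (- 2 * Phi0 y)))" using ui by simp
      show "AE y in lborel. norm (?f y) \<le> norm (K * ((cmod (u y))\<^sup>2 * exp (- 2 * Phi0 y)))"
        by (intro always_eventually allI) (use order_trans[OF fle abs_ge_self] in simp)
    qed measurable
    have hx: "?f ((1 / m) *s (x + - d)) = (cmod (Top_explicit u x))\<^sup>2 * exp (- 2 * Phi0 x)" for x
    proof -
      have "m *s ((1 / m) *s (x + - d)) + d = x"
        using m0 by (simp add: vec_eq_iff)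
      then show ?thesis
        by (simp add: Top_explicit_def Let_def m_def)
    qed
    have m0': "1 / m \<noteq> 0" using m0 by simp
    note 1 = has_bochner_integral_lborel_vec_smult[OF fi m0']
    have 2: "has_bochner_integral lborel (\<lambda>x. ?f ((1 / m) *s (x + - d))) (D * (\<integral>y. ?f y \<partial>lborel))"
      using has_bochner_integral_lborel_shift[of "\<lambda>x. ?f ((1 / m) *s x)" "- d"] 1
      by (simp add: has_bochner_integral_iff D_def norm_divide)
    then have 3: "has_bochner_integral lborel (\<lambda>x. (cmod (Top_explicit u x))\<^sup>2 * exp (- 2 * Phi0 x)) (D * (\<integral>y. ?f y \<partial>lborel))"
      unfolding hx .
    have hh: "holo_Cn (Top_explicit u)" by (rule holo_Top_explicit[OF hol])
    \<comment> \<open>The change of variables yields integrability as well as the value of the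
      integral, so membership in H is available before the projection is identified.\<close>
    have H: "Top_explicit u \<in> H_Phi0"
      using 3 hh holo_Cn_measurable[OF hh] by (auto simp: H_Phi0_def L2w_def has_bochner_integral_iff)
    have "(L2w_norm (Top Q u))\<^sup>2 = D * (\<integral>y. ?f y \<partial>lborel)"
    proof -
      have "(L2w_norm (Top_explicit u))\<^sup>2 = (\<integral>x. (cmod (Top_explicit u x))\<^sup>2 * exp (- 2 * Phi0 x) \<partial>lborel)"
        unfolding L2w_norm_def by (rule real_sqrt_pow2) simp
      then show ?thesis
        unfolding Top_eq_explicit[OF u H] has_bochner_integral_integral_eq[OF 3] .
    qed
    also have "\<dots> \<le> D * (\<integral>y. K * ((cmod (u y))\<^sup>2 * exp (- 2 * Phi0 y)) \<partial>lborel)"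
      using ui by (intro mult_left_mono integral_mono fi fle) (auto simp: D_def)
    also have "\<dots> = D * K * (L2w_norm u)\<^sup>2"
      unfolding L2w_norm_def by (subst real_sqrt_pow2) auto
    finally have "sqrt ((L2w_norm (Top Q u))\<^sup>2) \<le> sqrt (D * K * (L2w_norm u)\<^sup>2)"
      by (rule real_sqrt_le_mono)
    then show ?thesis
      by (simp add: real_sqrt_mult L2w_norm_def)
  qed
  then show ?thesis unfolding Top_bounded_def by blast
qed

section \<open>Lower bound by testing on coherent states\<close>

lemma coherent_Top_dom: "coherent w \<in> Top_dom Q"
proof -
  have "(\<lambda>x. exp (Q x) * coherent w x) \<in> L2w"
  proof (rule L2wI[OF _ lam, where K=1 and C="norm c / 2 + norm d / 2 + norm w / 2"])
    show "continuous_on UNIV (\<lambda>x. exp (Q x) * coherent w x)"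
      unfolding Q coherent_alt by (intro continuous_intros) auto
    fix y
    have "Re (cdot (vcnj c) y) \<le> norm c * norm y" "Re (- cdot d (vcnj y)) \<le> norm d * norm y" "Re (cdot (vcnj w) y) \<le> norm w * norm y"
      using order_trans[OF complex_Re_le_cmod norm_cdot_le[of "vcnj c" y]]
        order_trans[OF complex_Re_le_cmod norm_cdot_le[of "- d" "vcnj y"]]
        order_trans[OF complex_Re_le_cmod norm_cdot_le[of "vcnj w" y]] by (auto simp: cdot_minus_left)
    then show "cmod (exp (Q y) * coherent w y) \<le> 1 * exp (Re lam * (norm y)\<^sup>2 + (norm c / 2 + norm d / 2 + norm w / 2) * norm y)"
      unfolding Q coherent_def by (simp add: algebra_simps flip: exp_add)
  qed
  then show ?thesis
    using coherent_H_Phi0 by (simp add: Top_dom_def)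
qed

text \<open>The affine substitution and the exponential weight both preserve exponentials of affine
  functions, so the image is again a multiple of a coherent state and has an explicit norm.\<close>

lemma Top_coherent:
  "Top Q (coherent w) = (\<lambda>x. Top_factor TYPE('n) lam * exp (- cdot ((1 / (2 * (1 - 2 * lam))) *s vcnj (c + w)) d)
     * exp (cdot ((1 / (2 * (1 - 2 * lam))) *s vcnj (c + w)) x))" (is "_ = ?h")
proof -
  have "Top_explicit (coherent w) x = ?h x" for x
  proof -
    have "cdot ((1/2) *s vcnj c) ((1 / m) *s (x - d)) + cdot (vcnj w) ((1 / m) *s (x - d)) / 2
      = - cdot ((1 / (2 * m)) *s vcnj (c + w)) d + cdot ((1 / (2 * m)) *s vcnj (c + w)) x" if "m \<noteq> 0" for m
      using that by (simp add: cdot_linear vcnj_linear field_simps)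
    note this[OF mu_nonzero(1)]
    note this[THEN arg_cong[where f=exp]]
    then show ?thesis
      unfolding Top_explicit_def Let_def coherent_def by (simp only: exp_add mult_ac)
  qed
  then have e: "Top_explicit (coherent w) = ?h" by blast
  show ?thesis
    using Top_eq_explicit[OF coherent_Top_dom[of w]] unfolding e by (simp add: scaled_exp_cdot_H_Phi0)
qed

lemma Top_bounded_only_if:
  assumes "Top_bounded Q"
  shows "cmod (1 - 2 * lam) > 1 \<or> (cmod (1 - 2 * lam) = 1 \<and> c = cnj (1 - 2 * lam) *s d)"
proof -
  define m where "m = 1 - 2 * lam"
  have m0: "m \<noteq> 0" using mu_nonzero by (simp add: m_def)
  obtain r where r: "r > 0" "gaussC TYPE('n) (1/2) = of_real r"
    using gaussC_of_real_pos[of "1/2", where 'n='n] by auto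
  obtain C where C: "\<And>u. u \<in> Top_dom Q \<Longrightarrow> L2w_norm (Top Q u) \<le> C * L2w_norm u"
    using assms by (auto simp: Top_bounded_def)
  have T0: "cmod (Top_factor TYPE('n) lam) > 0" using Top_factor_nonzero by simp
  \<comment> \<open>The logarithm of the norm inequality on \<open>coherent w\<close>, with p the
    frequency of its image. The common factor \<open>sqrt r\<close> cancels.\<close>
  have main: "(norm p)\<^sup>2 - Re (cdot p d) - (norm w)\<^sup>2 / 4 \<le> ln (C / cmod (Top_factor TYPE('n) lam))"
    if p: "p = (1 / (2 * m)) *s vcnj (c + w)" for p w
  proof -
    have "L2w_norm (Top Q (coherent w)) = cmod (Top_factor TYPE('n) lam) * exp (- Re (cdot p d)) * sqrt r * exp ((norm p)\<^sup>2)"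
      unfolding Top_coherent m_def[symmetric] p[symmetric] L2w_norm_exp_cdot[OF r] by (simp add: norm_mult)
    moreover have "L2w_norm (coherent w) = sqrt r * exp ((norm w)\<^sup>2 / 4)"
      using L2w_norm_exp_cdot[OF r, of 1 "(1/2) *s vcnj w"] unfolding coherent_alt
      by (simp add: norm_vec_smult power_divide)
    ultimately have "sqrt r * (cmod (Top_factor TYPE('n) lam) * (exp (- Re (cdot p d)) * exp ((norm p)\<^sup>2))) \<le> sqrt r * (C * exp ((norm w)\<^sup>2 / 4))"
      using C[OF coherent_Top_dom[of w]] by (simp add: mult_ac)
    then have "cmod (Top_factor TYPE('n) lam) * (exp (- Re (cdot p d)) * exp ((norm p)\<^sup>2)) \<le> C * exp ((norm w)\<^sup>2 / 4)"
      using r(1) by simp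
    then have "exp (- Re (cdot p d)) * exp ((norm p)\<^sup>2) * exp (- ((norm w)\<^sup>2 / 4)) \<le> C / cmod (Top_factor TYPE('n) lam)"
      using T0 by (simp add: exp_minus field_simps)
    then have "exp ((norm p)\<^sup>2 - Re (cdot p d) - (norm w)\<^sup>2 / 4) \<le> C / cmod (Top_factor TYPE('n) lam)"
      by (simp add: algebra_simps flip: exp_add)
    \<comment> \<open>C is an arbitrary real number; the quotient is positive because it dominates
      an exponential, which permits taking \<open>ln\<close>.\<close>
    moreover from this have "C / cmod (Top_factor TYPE('n) lam) > 0" using exp_gt_zero less_le_trans by blast
    ultimately show ?thesis by (simp add: ln_ge_iff)
  qed
  \<comment> \<open>Sorting \<open>main\<close> by powers of w: |c + w|^2/(4|m|^2) - |w|^2/4 gives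
    \<alpha>, and its cross term together with -Re(p \<cdot> d) gives P.\<close>
  define P where "P = (1 / (2 * of_real ((cmod m)\<^sup>2))) *s c - (1 / (2 * m)) *s d"
  define \<alpha> where "\<alpha> = 1 / (4 * (cmod m)\<^sup>2) - 1 / 4"
  have "\<alpha> * (norm w)\<^sup>2 + Re (cdot P (vcnj w)) \<le> ln (C / cmod (Top_factor TYPE('n) lam))
      - (norm c)\<^sup>2 / (4 * (cmod m)\<^sup>2) + Re (cdot ((1 / (2 * m)) *s vcnj c) d)" for w
  proof -
    define p where "p = (1 / (2 * m)) *s vcnj (c + w)"
    have "(norm p)\<^sup>2 = (norm (c + w))\<^sup>2 / (4 * (cmod m)\<^sup>2)"
      by (simp add: p_def norm_vec_smult norm_divide norm_mult power_mult_distrib power_divide)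
    also have "\<dots> = (norm c)\<^sup>2 / (4 * (cmod m)\<^sup>2) + Re (cdot ((1 / (2 * of_real ((cmod m)\<^sup>2))) *s c) (vcnj w)) + (norm w)\<^sup>2 / (4 * (cmod m)\<^sup>2)"
    proof -
      have "Re (cdot ((1 / (2 * of_real ((cmod m)\<^sup>2))) *s c) (vcnj w)) = Re (of_real (1 / (2 * (cmod m)\<^sup>2)) * cdot c (vcnj w))"
        by (simp add: cdot_linear)
      also have "\<dots> = 1 / (2 * (cmod m)\<^sup>2) * Re (cdot c (vcnj w))"
        by (simp only: scaleR_conv_of_real[symmetric] scaleR_complex.sel)
      finally show ?thesis
        unfolding norm_add_sqr_cdot by (simp add: add_divide_distrib)
    qed
    finally have 1: "(norm p)\<^sup>2 = \<dots>" .
    have 2: "Re (cdot p d) = Re (cdot ((1 / (2 * m)) *s vcnj c) d) + Re (cdot ((1 / (2 * m)) *s d) (vcnj w))"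
      unfolding p_def by (simp add: vcnj_add cdot_linear cdot_commute[of "vcnj w"] ring_distribs add_divide_distrib)
    show ?thesis
      using main[OF p_def] unfolding 1 2 \<alpha>_def P_def by (simp add: cdot_diff_left left_diff_distrib)
  qed
  then have "\<alpha> < 0 \<or> (\<alpha> = 0 \<and> P = 0)"
    unfolding quadratic_bounded_above_iff[symmetric] by blast
  moreover have "cmod m > 1" if "\<alpha> < 0"
  proof -
    have "1 < (cmod m)\<^sup>2" using that m0 by (simp add: \<alpha>_def field_simps)
    then show ?thesis using power2_less_imp_less[of 1 "cmod m"] by simp
  qed
  moreover have "cmod m = 1" if "\<alpha> = 0"
  proof -
    have "(cmod m)\<^sup>2 = 1" using that m0 by (simp add: \<alpha>_def field_simps)
    then show ?thesis using power2_eq_iff_nonneg[of "cmod m" 1] by simp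
  qed
  moreover have "c = cnj m *s d" if "cmod m = 1" "P = 0"
  proof -
    have "m * cnj m = 1" using that(1) by (simp flip: complex_norm_square)
    then have im: "1 / m = cnj m" using m0 by (simp add: field_simps)
    have "c = 2 *s (P + (1 / (2 * m)) *s d)"
      using that(1) by (simp add: P_def vec_eq_iff)
    also have "\<dots> = (1 / m) *s d" using that(2) by (simp add: vec_eq_iff)
    finally show ?thesis unfolding im .
  qed
  ultimately show ?thesis unfolding m_def[symmetric] by blast
qed

section \<open>The Weyl symbol and its boundedness\<close>

lemma weyl_symbol_eq:
  "weyl_symbol_Top Q x = of_real (pi powr (- real CARD('n))) * (exp (- of_real ((norm x)\<^sup>2)) *
     (gaussC TYPE('n) (1 - lam) * exp (cdot (vcnj x + (1/2) *s vcnj c) (x - (1/2) *s d) / (1 - lam))))"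
proof -
  have a: "Re (1 - lam) > 0" using lam by simp
  \<comment> \<open>Expanding |x - y|^2 gives the integrand of \<open>gauss_exp_integral\<close>
    with a = 1 - \<lambda>, q = x - d/2 and p = conj x + conj c/2.\<close>
  have e: "complex_of_real (exp (- (norm (x - y))\<^sup>2)) * exp (Q y) = exp (- of_real ((norm x)\<^sup>2)) *
      (exp (cdot (x - (1/2) *s d) (vcnj y) - (1 - lam) * of_real ((norm y)\<^sup>2)) * exp (cdot (vcnj x + (1/2) *s vcnj c) y))" for y
  proof -
    have "of_real (- (norm (x - y))\<^sup>2) = - cdot (x - y) (vcnj (x - y))"
      by (simp add: cdot_vcnj_self)
    also have "\<dots> = - cdot x (vcnj x) + cdot x (vcnj y) + cdot (vcnj x) y - cdot y (vcnj y)"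
      by (simp add: cdot_linear vcnj_linear cdot_commute[of "vcnj x"])
    finally have "of_real (- (norm (x - y))\<^sup>2) + Q y = - of_real ((norm x)\<^sup>2) +
      (cdot (x - (1/2) *s d) (vcnj y) - (1 - lam) * of_real ((norm y)\<^sup>2) + cdot (vcnj x + (1/2) *s vcnj c) y)"
      unfolding cdot_vcnj_self Q by (simp add: cdot_linear algebra_simps)
    note this[THEN arg_cong[where f=exp]]
    then show ?thesis by (simp only: exp_of_real[symmetric] exp_add)
  qed
  show ?thesis
    unfolding weyl_symbol_Top_def e integral_mult_right_zero gauss_exp_integral[OF a] ..
qed

lemma weyl_bounded_iff:
  "Linfty_Lambda (weyl_symbol_Top Q) \<longleftrightarrow>
    cmod (1 - 2 * lam) > 1 \<or> (cmod (1 - 2 * lam) = 1 \<and> c = cnj (1 - 2 * lam) *s d)"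
proof -
  define b where "b = 1 / (1 - lam)"
  have a: "Re (1 - lam) > 0" using lam by simp
  define K where "K = pi powr (- real CARD('n)) * cmod (gaussC TYPE('n) (1 - lam)) * exp (- Re (b * cdot (vcnj c) d) / 4)"
  have K: "K > 0" unfolding K_def using gaussC_nonzero[OF a, where 'n='n] by simp
  \<comment> \<open>E is the part of the real exponent that varies with x; the modulus of everything
    constant is collected in K.\<close>
  define E where "E = (\<lambda>x. (Re b - 1) * (norm x)\<^sup>2 + Re (cdot ((cnj b / 2) *s c - (b / 2) *s d) (vcnj x)))"
  have norm: "cmod (weyl_symbol_Top Q x) = K * exp (E x)" for x
  proof -
    define Z where "Z = b * cdot (vcnj x + (1/2) *s vcnj c) (x - (1/2) *s d)"
    have "Re (cdot (b *s vcnj c) x) = Re (cdot (cnj b *s c) (vcnj x))"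
      using Re_cdot_vcnj_commute[of "cnj b *s c" x] by (simp add: vcnj_linear cdot_linear cdot_commute[of x])
    then have 1: "Re (cdot ((cnj b / 2) *s c) (vcnj x)) = Re (cdot (b *s vcnj c) x) / 2"
      by (simp add: cdot_linear)
    have "Z = of_real ((norm x)\<^sup>2) * b - cdot ((b / 2) *s d) (vcnj x) + cdot (b *s vcnj c) x / 2 - b * cdot (vcnj c) d / 4"
      unfolding Z_def cdot_vcnj_self[symmetric]
      by (simp add: cdot_linear cdot_commute[of "vcnj x"] algebra_simps)
    then have "Re Z = (norm x)\<^sup>2 * Re b - Re (cdot ((b / 2) *s d) (vcnj x)) + Re (cdot (b *s vcnj c) x) / 2 - Re (b * cdot (vcnj c) d) / 4"
      by (simp del: of_real_power)
    then have Z: "- (norm x)\<^sup>2 + Re Z = E x + - Re (b * cdot (vcnj c) d) / 4"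
      unfolding E_def cdot_diff_left minus_complex.sel 1
      by (simp add: algebra_simps del: times_complex.sel)
    have "cmod (weyl_symbol_Top Q x) = pi powr (- real CARD('n)) * (exp (- (norm x)\<^sup>2) *
        (cmod (gaussC TYPE('n) (1 - lam)) * exp (Re Z)))"
      unfolding weyl_symbol_eq Z_def b_def norm_mult by simp
    also have "\<dots> = pi powr (- real CARD('n)) * cmod (gaussC TYPE('n) (1 - lam)) * exp (- (norm x)\<^sup>2 + Re Z)"
      by (simp only: exp_add mult_ac)
    also have "\<dots> = K * exp (E x)"
      unfolding Z K_def by (simp only: exp_add mult_ac)
    finally show ?thesis .
  qed
  have cont: "continuous_on UNIV (weyl_symbol_Top Q)"
    unfolding weyl_symbol_eq[abs_def] using mu_nonzero by (intro continuous_intros) auto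
  have "Linfty_Lambda (weyl_symbol_Top Q) \<longleftrightarrow> (\<exists>C. \<forall>x. K * exp (E x) \<le> C)"
    by (simp add: Linfty_iff_bounded[OF cont] norm)
  also have "\<dots> \<longleftrightarrow> (\<exists>B. \<forall>x. E x \<le> B)"
  proof
    assume "\<exists>C. \<forall>x. K * exp (E x) \<le> C"
    then obtain C where "\<And>x. K * exp (E x) \<le> C" by blast
    then have C: "exp (E x) \<le> C / K" for x using K by (simp add: field_simps)
    then have "C / K > 0" using exp_gt_zero less_le_trans by blast
    then have "E x \<le> ln (C / K)" for x using C by (simp add: ln_ge_iff)
    then show "\<exists>B. \<forall>x. E x \<le> B" by blast
  next
    assume "\<exists>B. \<forall>x. E x \<le> B"
    then obtain B where "\<And>x. E x \<le> B" by blast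
    then have "K * exp (E x) \<le> K * exp B" for x using K by simp
    then show "\<exists>C. \<forall>x. K * exp (E x) \<le> C" by blast
  qed
  also have "\<dots> \<longleftrightarrow> Re b - 1 < 0 \<or> (Re b - 1 = 0 \<and> (cnj b / 2) *s c - (b / 2) *s d = 0)"
    unfolding E_def by (rule quadratic_bounded_above_iff)
  also have "\<dots> \<longleftrightarrow> cmod (1 - 2 * lam) > 1 \<or> (cmod (1 - 2 * lam) = 1 \<and> c = cnj (1 - 2 * lam) *s d)"
  proof -
    have l0: "(cmod (1 - lam))\<^sup>2 > 0" using mu_nonzero by simp
    \<comment> \<open>Since 1 - 2\<lambda> = (2 - b)/b, having modulus above 1 means |2 - b| > |b|,
      that is, Re b < 1.\<close>
    have 1: "Re b - 1 = (1 - (cmod (1 - 2 * lam))\<^sup>2) / (4 * (cmod (1 - lam))\<^sup>2)"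
    proof -
      have "Re b = (1 - Re lam) / (cmod (1 - lam))\<^sup>2"
        by (simp add: b_def Re_divide cmod_power2)
      moreover have "(1 - (cmod (1 - 2 * lam))\<^sup>2) = 4 * ((1 - Re lam) - (cmod (1 - lam))\<^sup>2)"
        by (simp add: cmod_power2) (simp add: power2_eq_square algebra_simps)
      ultimately show ?thesis using l0 by (simp add: field_simps)
    qed
    have lt: "Re b - 1 < 0 \<longleftrightarrow> cmod (1 - 2 * lam) > 1"
      unfolding 1 using l0 power2_less_imp_less[of 1 "cmod (1 - 2 * lam)"]
      by (auto simp: divide_less_0_iff one_less_power)
    have eq: "Re b - 1 = 0 \<longleftrightarrow> cmod (1 - 2 * lam) = 1"
      unfolding 1 using l0 power2_eq_iff_nonneg[of "cmod (1 - 2 * lam)" 1] by auto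
    have "(cnj b / 2) *s c - (b / 2) *s d = 0 \<longleftrightarrow> c = cnj (1 - 2 * lam) *s d" if "cmod (1 - 2 * lam) = 1"
    proof -
      have bc: "cnj b \<noteq> 0" using mu_nonzero by (simp add: b_def)
      have "(1 - 2 * lam) * (1 - 2 * cnj lam) = 1"
        using that complex_norm_square[of "1 - 2 * lam"] by simp
      \<comment> \<open>With \<mu> = 1 - 2\<lambda> on the unit circle, 1 + conj \<mu> = conj \<mu>
        (1 + \<mu>), and 1 + \<mu> = 2(1 - \<lambda>). Hence b = conj b conj \<mu>, and conj b/2
        factors out of the linear coefficient.\<close>
      then have "2 * cnj (1 - lam) = 2 * (cnj (1 - 2 * lam) * (1 - lam))"
        by (simp add: algebra_simps)
      then have "cnj (1 - lam) = cnj (1 - 2 * lam) * (1 - lam)"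
        by (simp only: mult_cancel_left) simp
      moreover have "1 / X = 1 / Y * M" if "Y = M * X" "X \<noteq> 0" "Y \<noteq> 0" for X Y M :: complex
        using that by auto
      ultimately have b: "b = cnj b * cnj (1 - 2 * lam)"
        using mu_nonzero(2) unfolding b_def complex_cnj_divide complex_cnj_one
        by (metis complex_cnj_zero_iff)
      have "(cnj b / 2) *s c - (b / 2) *s d = (cnj b / 2) *s (c - cnj (1 - 2 * lam) *s d)"
      proof -
        have "b / 2 = cnj b / 2 * cnj (1 - 2 * lam)"
          using arg_cong[OF b, of "\<lambda>z. z / 2"] by (simp only: times_divide_eq_left)
        then have "(b / 2) *s d = (cnj b / 2) *s (cnj (1 - 2 * lam) *s d)"
          by (simp only: vector_smult_assoc)
        then show ?thesis by (simp only: vector_ssub_ldistrib)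
      qed
      moreover have "(cnj b / 2) *s v = 0 \<longleftrightarrow> v = 0" for v :: "complex^'n"
        using bc by (simp add: vec_eq_iff)
      ultimately show ?thesis by (simp only: right_minus_eq)
    qed
    then show ?thesis using lt eq by blast
  qed
  finally show ?thesis .
qed

end

theorem theorem4p2:
  fixes c d :: "complex ^ 'n::finite" and lam :: complex
    and Q :: "complex ^ 'n \<Rightarrow> complex"
  assumes "Re lam < 1/4"
    and "\<And>x. Q x = lam * complex_of_real ((norm x)\<^sup>2) + cdot (vcnj c) x / 2 - cdot d (vcnj x) / 2"
  shows "Top_bounded Q \<longleftrightarrow> Linfty_Lambda (weyl_symbol_Top Q)"
  using Top_bounded_if[OF assms] Top_bounded_only_if[OF assms] weyl_bounded_iff[OF assms] by blast

end
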